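(* Let $X$ be a (complex) $(\mathrm{AM})$-space and let $(T_t)_{t\ge0}$ be a uniformly eventually positive and Kreiss bounded $C_0$-semigroup on $X$. Then there exists $\epsilon\in(0,1)$ such that, as $t\to+\infty$, $$\|T_t\|=\mathcal{O}(t^{1-\epsilon}).$$
   Context: A (complex) Banach lattice is the complexification $X=X_{\mathbb{R}}+iX_{\mathbb{R}}$ of a real Banach lattice $X_{\mathbb{R}}$, with positive cone $X_+$. A Banach lattice $X$ is an $(\mathrm{AM})$-space if $\|\sup(x,y)\|=\sup(\|x\|,\|y\|)$ for all $x,y\in X_+$. Let $-A$ denote the generator of a $C_0$-semigroup $(T_t)_{t\ge0}$ on a complex Banach space $X$. Write $\mathbb{C}_+=\{\lambda\in\mathbb{C}:\operatorname{Re}\lambda>0\}$, $\mathbb{C}_-=\{\lambda\in\mathbb{C}:\operatorname{Re}\lambda<0\}$, $\rho(A)$ for the resolvent set of $A$ and $R(\mu,A)=(\mu-A)^{-1}$ for $\mu\in\rho(A)$. The semigroup is Kreiss bounded if $\mathbb{C}_-\subseteq\rho(A)$ and there is a constant $C$ such that $\|R(-\lambda,A)\|\le C/\operatorname{Re}(\lambda)$ for every $\lambda\in\mathbb{C}_+$. A bounded operator $S$ on $X$ is positive if $Sx\in X_+$ whenever $x\in X_+$. The semigroup is uniformly eventually positive if there exists $t_0\ge0$ such that $T_t$ is a positive operator for every $t\ge t_0$. *)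

theory Defs
  imports
    "HOL-Analysis.Analysis"
    "HOL-Library.Lattice_Algebras"
    "HOL-Library.Landau_Symbols"
begin

section \<open>Real Banach lattices and AM-spaces\<close>

class real_banach_lattice = banach + ordered_real_vector + lattice_ab_group_add_abs +
  assumes norm_le_if_abs_le: "\<bar>x\<bar> \<le> \<bar>y\<bar> \<Longrightarrow> norm x \<le> norm y"

class real_am_space = real_banach_lattice +
  assumes norm_sup_eq_max: "0 \<le> x \<Longrightarrow> 0 \<le> y \<Longrightarrow> norm (sup x y) = max (norm x) (norm y)"

instance real :: real_am_space
  by intro_classes (auto simp: sup_real_def abs_real_def max_def)

lemma norm_abs_lattice: "norm \<bar>x\<bar> = norm (x :: 'a::real_banach_lattice)"
  by (simp add: norm_le_if_abs_le antisym)

lemma norm_mono_nonneg: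
  fixes x y :: "'a::real_banach_lattice"
  assumes "0 \<le> x" "x \<le> y"
  shows "norm x \<le> norm y"
  using assms by (intro norm_le_if_abs_le) (simp add: abs_of_nonneg)

lemma nonneg_limit:
  fixes X :: "nat \<Rightarrow> 'a::real_banach_lattice"
  assumes lim: "X \<longlonglongrightarrow> x" and nonneg: "\<And>n. 0 \<le> X n"
  shows "0 \<le> x"
proof -
  have bound: "norm (inf x 0) \<le> norm (X n - x)" for n
  proof (rule norm_le_if_abs_le)
    have "x = X n - (X n - x)" by simp
    also have "\<dots> \<ge> 0 - \<bar>X n - x\<bar>"
      by (intro diff_mono nonneg abs_ge_self)
    finally have "- \<bar>X n - x\<bar> \<le> inf x 0" by simp
    then have "- inf x 0 \<le> \<bar>X n - x\<bar>" by (metis minus_le_iff)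
    moreover have "inf x 0 \<le> \<bar>X n - x\<bar>" by (meson abs_ge_zero inf_le2 order_trans)
    ultimately show "\<bar>inf x 0\<bar> \<le> \<bar>X n - x\<bar>" by (simp add: abs_leI)
  qed
  have "(\<lambda>n. norm (X n - x)) \<longlonglongrightarrow> 0"
    using lim by (simp add: LIM_zero tendsto_norm_zero)
  then have "norm (inf x 0) \<le> 0"
    by (rule LIMSEQ_le_const) (use bound in auto)
  then have "inf x 0 = 0" by simp
  then show ?thesis by (metis inf_le1)
qed

lemma lattice_limit_le:
  fixes X :: "nat \<Rightarrow> 'a::real_banach_lattice"
  assumes "X \<longlonglongrightarrow> x" "Y \<longlonglongrightarrow> y" "\<And>n. X n \<le> Y n"
  shows "x \<le> y"
  using nonneg_limit[OF tendsto_diff[OF assms(2,1)]] assms(3) by simp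

lemma abs_scaleR_lattice: "\<bar>r *\<^sub>R x\<bar> = \<bar>r\<bar> *\<^sub>R \<bar>x :: 'a::real_banach_lattice\<bar>"
proof -
  have le: "\<bar>c *\<^sub>R z\<bar> \<le> c *\<^sub>R \<bar>z\<bar>" if "0 \<le> c" for c and z :: 'a
    by (intro abs_leI)
      (use scaleR_left_mono[OF abs_ge_self that, of z]
           scaleR_left_mono[OF abs_ge_minus_self that, of z] in auto)
  have pos: "\<bar>c *\<^sub>R z\<bar> = c *\<^sub>R \<bar>z\<bar>" if c: "0 < c" for c and z :: 'a
  proof (rule antisym)
    have "\<bar>inverse c *\<^sub>R (c *\<^sub>R z)\<bar> \<le> inverse c *\<^sub>R \<bar>c *\<^sub>R z\<bar>"
      using c by (intro le) simp
    from scaleR_left_mono[OF this, of c] show "c *\<^sub>R \<bar>z\<bar> \<le> \<bar>c *\<^sub>R z\<bar>"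
      using c by simp
  qed (use le[of c] c in auto)
  consider "r > 0" | "r = 0" | "r < 0" by linarith
  then show ?thesis
  proof cases
    case 3
    then have "\<bar>(- r) *\<^sub>R x\<bar> = (- r) *\<^sub>R \<bar>x\<bar>" by (intro pos) simp
    with 3 show ?thesis by simp
  qed (use pos in auto)
qed

section \<open>The modulus\<close>

definition rot :: "'a::real_banach_lattice \<Rightarrow> 'a \<Rightarrow> real \<Rightarrow> 'a"
  where "rot x y \<theta> = cos \<theta> *\<^sub>R x + sin \<theta> *\<^sub>R y"

text \<open>
  The modulus of \<open>x + i y\<close> is the supremum of \<open>Re (exp (- i \<theta>) (x + i y))\<close> over all real
  \<open>\<theta>\<close>. It exists in every Banach lattice: see \<open>modulus_upper\<close> and \<open>modulus_least\<close>.
\<close>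
definition modulus :: "'a::real_banach_lattice \<Rightarrow> 'a \<Rightarrow> 'a"
  where "modulus x y = (LEAST u. \<forall>\<theta>::real. cos \<theta> *\<^sub>R x + sin \<theta> *\<^sub>R y \<le> u)"

lemma rot_diff_le:
  "rot x y s - rot x y t \<le> \<bar>s - t\<bar> *\<^sub>R (\<bar>x\<bar> + \<bar>y\<bar>)"
proof -
  have cos: "\<bar>cos s - cos t\<bar> \<le> \<bar>s - t\<bar>"
  proof -
    have "\<bar>cos s - cos t\<bar> = 2 * (\<bar>sin ((s + t) / 2)\<bar> * \<bar>sin ((t - s) / 2)\<bar>)"
      by (simp add: cos_diff_cos abs_mult)
    also have "\<dots> \<le> 2 * (1 * \<bar>(t - s) / 2\<bar>)"
      by (intro mult_left_mono mult_mono abs_sin_x_le_abs_x) auto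
    finally show ?thesis by simp
  qed
  have sin: "\<bar>sin s - sin t\<bar> \<le> \<bar>s - t\<bar>"
  proof -
    have "\<bar>sin s - sin t\<bar> = 2 * (\<bar>sin ((s - t) / 2)\<bar> * \<bar>cos ((s + t) / 2)\<bar>)"
      by (simp add: sin_diff_sin abs_mult)
    also have "\<dots> \<le> 2 * (\<bar>(s - t) / 2\<bar> * 1)"
      by (intro mult_left_mono mult_mono abs_sin_x_le_abs_x) auto
    finally show ?thesis by simp
  qed
  have "rot x y s - rot x y t = (cos s - cos t) *\<^sub>R x + (sin s - sin t) *\<^sub>R y"
    by (simp add: rot_def algebra_simps)
  also have "\<dots> \<le> \<bar>(cos s - cos t) *\<^sub>R x\<bar> + \<bar>(sin s - sin t) *\<^sub>R y\<bar>"
    by (intro add_mono abs_ge_self)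
  also have "\<dots> \<le> \<bar>s - t\<bar> *\<^sub>R \<bar>x\<bar> + \<bar>s - t\<bar> *\<^sub>R \<bar>y\<bar>"
    unfolding abs_scaleR_lattice by (intro add_mono scaleR_right_mono cos sin) auto
  finally show ?thesis by (simp add: scaleR_add_right)
qed

lemma rot_grid:
  assumes "0 < N"
  shows "\<exists>k\<le>N. rot x y \<theta> \<le> rot x y (2 * pi * real k / real N)
                 + (2 * pi / real N) *\<^sub>R (\<bar>x\<bar> + \<bar>y\<bar>)"
proof -
  obtain t where t: "0 \<le> t" "t < 2 * pi" "cos \<theta> = cos t" "sin \<theta> = sin t"
    using sincos_total_2pi[of "cos \<theta>" "sin \<theta>"] by auto
  define k where "k = nat \<lfloor>t * real N / (2 * pi)\<rfloor>"
  have nn: "0 \<le> t * real N / (2 * pi)" using t by simp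
  have k1: "real k \<le> t * real N / (2 * pi)"
    unfolding k_def using nn by (metis of_nat_floor)
  have k2: "t * real N / (2 * pi) < real k + 1"
    unfolding k_def using nn by linarith
  have "t * real N / (2 * pi) \<le> real N"
    using t assms by (simp add: field_simps)
  with k1 have kN: "k \<le> N" by linarith
  have a: "2 * pi * real k / real N \<le> t"
    using k1 assms by (simp add: field_simps)
  have b: "t - 2 * pi * real k / real N \<le> 2 * pi / real N"
  proof -
    have "t * real N < 2 * pi * (real k + 1)" using k2 by (simp add: field_simps)
    then have "t < 2 * pi * (real k + 1) / real N" using assms by (simp add: pos_less_divide_eq)
    also have "\<dots> = 2 * pi * real k / real N + 2 * pi / real N"
      by (simp add: distrib_left add_divide_distrib)
    finally show ?thesis by simp
  qed
  have "rot x y \<theta> = rot x y t" using t by (simp add: rot_def)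
  also have "\<dots> \<le> rot x y (2 * pi * real k / real N)
      + \<bar>t - 2 * pi * real k / real N\<bar> *\<^sub>R (\<bar>x\<bar> + \<bar>y\<bar>)"
    using rot_diff_le[of x y t "2 * pi * real k / real N"] by (simp add: algebra_simps)
  also have "\<dots> \<le> rot x y (2 * pi * real k / real N) + (2 * pi / real N) *\<^sub>R (\<bar>x\<bar> + \<bar>y\<bar>)"
    using a b by (intro add_left_mono scaleR_right_mono) auto
  finally show ?thesis using kN by blast
qed

lemma rot_sup_exists:
  fixes x y :: "'a::real_banach_lattice"
  shows "\<exists>m. (\<forall>\<theta>. rot x y \<theta> \<le> m) \<and> (\<forall>u. (\<forall>\<theta>. rot x y \<theta> \<le> u) \<longrightarrow> m \<le> u)"
proof -
  define w where "w = \<bar>x\<bar> + \<bar>y\<bar>"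
  have w: "0 \<le> w" by (simp add: w_def)
  define e where "e n = 2 * pi / real (Suc n)" for n
  have e: "0 \<le> e n" for n by (simp add: e_def)
  define F where "F n = (\<lambda>k. rot x y (2 * pi * real k / real (Suc n))) ` {..Suc n}" for n
  have F: "finite (F n)" "F n \<noteq> {}" for n by (auto simp: F_def)
  define s where "s n = Sup_fin (F n)" for n
  have up: "rot x y \<theta> \<le> s n + e n *\<^sub>R w" for \<theta> n
  proof -
    from rot_grid[of "Suc n" x y \<theta>] obtain k where k: "k \<le> Suc n"
      "rot x y \<theta> \<le> rot x y (2 * pi * real k / real (Suc n)) + e n *\<^sub>R w"
      unfolding e_def w_def by blast
    have "rot x y (2 * pi * real k / real (Suc n)) \<le> s n"
      unfolding s_def using k(1) by (intro Sup_fin.coboundedI F) (auto simp: F_def)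
    with k(2) show ?thesis by (meson add_right_mono order_trans)
  qed
  have least: "s n \<le> u" if "\<And>\<theta>. rot x y \<theta> \<le> u" for n u
    unfolding s_def by (intro Sup_fin.boundedI F) (auto simp: F_def that)
  have s_le: "s m \<le> s n + e n *\<^sub>R w" for m n
    by (intro least up)
  have dist: "norm (s m - s n) \<le> (e m + e n) * norm w" for m n
  proof -
    have "0 \<le> e m *\<^sub>R w" "0 \<le> e n *\<^sub>R w" using e w by (auto intro: scaleR_nonneg_nonneg)
    moreover have "s m - s n \<le> e n *\<^sub>R w" "s n - s m \<le> e m *\<^sub>R w"
      using s_le[of m n] s_le[of n m] by (auto simp: algebra_simps)
    ultimately have "s m - s n \<le> (e m + e n) *\<^sub>R w" "- (s m - s n) \<le> (e m + e n) *\<^sub>R w"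
      by (auto simp: scaleR_add_left intro: add_increasing add_increasing2)
    then have "\<bar>s m - s n\<bar> \<le> (e m + e n) *\<^sub>R w" by (rule abs_leI)
    also have "\<dots> \<le> \<bar>(e m + e n) *\<^sub>R w\<bar>" by (rule abs_ge_self)
    finally have "norm (s m - s n) \<le> norm ((e m + e n) *\<^sub>R w)" by (rule norm_le_if_abs_le)
    then show ?thesis using e[of m] e[of n] by simp
  qed
  have e0: "e \<longlonglongrightarrow> 0"
  proof -
    have "(\<lambda>n. (2 * pi) * inverse (real (Suc n))) \<longlonglongrightarrow> (2 * pi) * 0"
      by (intro tendsto_mult tendsto_const LIMSEQ_inverse_real_of_nat)
    then show ?thesis by (simp add: e_def[abs_def] divide_inverse)
  qed
  have "Cauchy s"
  proof (rule CauchyI)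
    fix r :: real assume r: "0 < r"
    have "(\<lambda>n. e n * norm w) \<longlonglongrightarrow> 0" using tendsto_mult_right[OF e0, of "norm w"] by simp
    then have "eventually (\<lambda>n. e n * norm w < r / 2) sequentially"
      using r by (intro order_tendstoD(2)) auto
    then obtain M where M: "\<And>n. n \<ge> M \<Longrightarrow> e n * norm w < r / 2"
      by (auto simp: eventually_sequentially)
    show "\<exists>M. \<forall>m\<ge>M. \<forall>n\<ge>M. norm (s m - s n) < r"
    proof (intro exI allI impI)
      fix m n assume "M \<le> m" "M \<le> n"
      then have "(e m + e n) * norm w < r"
        using M[of m] M[of n] by (simp add: distrib_right)
      then show "norm (s m - s n) < r" using dist[of m n] by linarith
    qed
  qed
  then obtain m where m: "s \<longlonglongrightarrow> m" by (auto simp: Cauchy_convergent_iff convergent_def)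
  have m': "(\<lambda>n. s n + e n *\<^sub>R w) \<longlonglongrightarrow> m"
    using tendsto_add[OF m tendsto_scaleR[OF e0 tendsto_const[of w]]] by simp
  show ?thesis
  proof (intro exI conjI allI impI)
    show "rot x y \<theta> \<le> m" for \<theta>
      by (rule lattice_limit_le[OF tendsto_const m']) (rule up)
    show "m \<le> u" if "\<forall>\<theta>. rot x y \<theta> \<le> u" for u
      by (rule lattice_limit_le[OF m tendsto_const]) (use that least in blast)
  qed
qed

lemma
  modulus_upper: "cos \<theta> *\<^sub>R x + sin \<theta> *\<^sub>R y \<le> modulus x y"
  and modulus_least: "(\<And>\<theta>. cos \<theta> *\<^sub>R x + sin \<theta> *\<^sub>R y \<le> u) \<Longrightarrow> modulus x y \<le> u"
proof -
  obtain m where m: "\<And>\<theta>. rot x y \<theta> \<le> m" "\<And>u. (\<And>\<theta>. rot x y \<theta> \<le> u) \<Longrightarrow> m \<le> u"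
    using rot_sup_exists[of x y] by blast
  have "modulus x y = m"
    unfolding modulus_def using m by (intro Least_equality) (auto simp: rot_def)
  with m show "cos \<theta> *\<^sub>R x + sin \<theta> *\<^sub>R y \<le> modulus x y"
    and "(\<And>\<theta>. cos \<theta> *\<^sub>R x + sin \<theta> *\<^sub>R y \<le> u) \<Longrightarrow> modulus x y \<le> u"
    by (auto simp: rot_def)
qed

lemma modulus_ge1: "\<bar>x\<bar> \<le> modulus x y"
  using modulus_upper[of 0 x y] modulus_upper[of pi x y] by (auto intro: abs_leI)

lemma modulus_ge2: "\<bar>y\<bar> \<le> modulus x y"
  using modulus_upper[of "pi/2" x y] modulus_upper[of "-(pi/2)" x y] by (auto intro: abs_leI)

lemma modulus_nonneg [simp]: "0 \<le> modulus x y"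
  using modulus_ge1[of x y] by (meson abs_ge_zero order_trans)

lemma modulus_le: "modulus x y \<le> \<bar>x\<bar> + \<bar>y\<bar>"
proof (rule modulus_least)
  fix \<theta> :: real
  have "cos \<theta> *\<^sub>R x + sin \<theta> *\<^sub>R y \<le> \<bar>cos \<theta> *\<^sub>R x\<bar> + \<bar>sin \<theta> *\<^sub>R y\<bar>"
    by (intro add_mono abs_ge_self)
  also have "\<dots> \<le> 1 *\<^sub>R \<bar>x\<bar> + 1 *\<^sub>R \<bar>y\<bar>"
    unfolding abs_scaleR_lattice by (intro add_mono scaleR_right_mono) auto
  finally show "cos \<theta> *\<^sub>R x + sin \<theta> *\<^sub>R y \<le> \<bar>x\<bar> + \<bar>y\<bar>" by simp
qed

lemma modulus_real: "modulus x 0 = \<bar>x\<bar>"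
  using modulus_le[of x 0] modulus_ge1[of x 0] by (simp add: antisym)

lemma modulus_triangle: "modulus (x + x') (y + y') \<le> modulus x y + modulus x' y'"
proof (rule modulus_least)
  fix \<theta> :: real
  show "cos \<theta> *\<^sub>R (x + x') + sin \<theta> *\<^sub>R (y + y') \<le> modulus x y + modulus x' y'"
    using add_mono[OF modulus_upper[of \<theta> x y] modulus_upper[of \<theta> x' y']]
    by (simp add: algebra_simps)
qed

lemma modulus_scaleC_le:
  "modulus (Re c *\<^sub>R x - Im c *\<^sub>R y) (Im c *\<^sub>R x + Re c *\<^sub>R y) \<le> cmod c *\<^sub>R modulus x y"
proof (rule modulus_least)
  fix \<theta> :: real
  have c: "Re c = cmod c * cos (Arg c)" "Im c = cmod c * sin (Arg c)"
    by (metis Re_rcis Im_rcis rcis_cmod_Arg)+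
  have "cos \<theta> *\<^sub>R (Re c *\<^sub>R x - Im c *\<^sub>R y) + sin \<theta> *\<^sub>R (Im c *\<^sub>R x + Re c *\<^sub>R y)
      = (cos \<theta> * Re c + sin \<theta> * Im c) *\<^sub>R x + (sin \<theta> * Re c - cos \<theta> * Im c) *\<^sub>R y"
    by (simp add: algebra_simps)
  also have "cos \<theta> * Re c + sin \<theta> * Im c = cmod c * cos (\<theta> - Arg c)"
    unfolding c cos_diff by (simp add: algebra_simps)
  also have "sin \<theta> * Re c - cos \<theta> * Im c = cmod c * sin (\<theta> - Arg c)"
    unfolding c sin_diff by (simp add: algebra_simps)
  also have "(cmod c * cos (\<theta> - Arg c)) *\<^sub>R x + (cmod c * sin (\<theta> - Arg c)) *\<^sub>R y
      = cmod c *\<^sub>R (cos (\<theta> - Arg c) *\<^sub>R x + sin (\<theta> - Arg c) *\<^sub>R y)"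
    by (simp add: algebra_simps)
  also have "\<dots> \<le> cmod c *\<^sub>R modulus x y"
    by (intro scaleR_left_mono modulus_upper) simp
  finally show "cos \<theta> *\<^sub>R (Re c *\<^sub>R x - Im c *\<^sub>R y) + sin \<theta> *\<^sub>R (Im c *\<^sub>R x + Re c *\<^sub>R y)
      \<le> cmod c *\<^sub>R modulus x y" .
qed

section \<open>Complex Banach spaces\<close>

class scaleC =
  fixes scaleC :: "complex \<Rightarrow> 'a \<Rightarrow> 'a"  (infixr \<open>*\<^sub>C\<close> 75)

class complex_banach = banach + scaleC +
  assumes scaleC_add_right: "a *\<^sub>C (x + y) = a *\<^sub>C x + a *\<^sub>C y"
    and scaleC_add_left: "(a + b) *\<^sub>C x = a *\<^sub>C x + b *\<^sub>C x"
    and scaleC_scaleC: "a *\<^sub>C (b *\<^sub>C x) = (a * b) *\<^sub>C x"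
    and scaleC_of_real: "complex_of_real r *\<^sub>C x = r *\<^sub>R x"
    and norm_scaleC: "norm (a *\<^sub>C x) = cmod a * norm x"

section \<open>The complexification of a real Banach lattice\<close>

text \<open>\<open>Cplx x y\<close> stands for \<open>x + i y\<close>.\<close>

datatype 'a complexification = Cplx (RePart: 'a) (ImPart: 'a)

instantiation complexification :: (real_banach_lattice) "{real_normed_vector, scaleC}"
begin

definition "0 = Cplx 0 0"
definition "z + w = Cplx (RePart z + RePart w) (ImPart z + ImPart w)"
definition "- z = Cplx (- RePart z) (- ImPart z)"
definition "z - w = Cplx (RePart z - RePart w) (ImPart z - ImPart w)"
definition "r *\<^sub>R z = Cplx (r *\<^sub>R RePart z) (r *\<^sub>R ImPart z)"
definition "c *\<^sub>C z = Cplx (Re c *\<^sub>R RePart z - Im c *\<^sub>R ImPart z)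
                         (Im c *\<^sub>R RePart z + Re c *\<^sub>R ImPart z)"
definition "norm z = norm (modulus (RePart z) (ImPart z))"
definition "dist z w = norm (z - w :: 'a complexification)"
definition "sgn z = inverse (norm z) *\<^sub>R (z :: 'a complexification)"
definition "(uniformity :: ('a complexification \<times> 'a complexification) filter) =
  (INF e\<in>{0 <..}. principal {(z, w). dist z w < e})"
definition "open (U :: 'a complexification set) \<longleftrightarrow>
  (\<forall>z\<in>U. eventually (\<lambda>(z', w). z' = z \<longrightarrow> w \<in> U) uniformity)"

lemmas complexification_ops = zero_complexification_def plus_complexification_def
  uminus_complexification_def minus_complexification_def scaleR_complexification_def
  scaleC_complexification_def

lemma complexification_sel [simp]:
  "RePart (0 :: 'a complexification) = 0" "ImPart (0 :: 'a complexification) = 0"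
  "RePart (z + w) = RePart z + RePart (w :: 'a complexification)"
  "ImPart (z + w) = ImPart z + ImPart (w :: 'a complexification)"
  "RePart (z - w) = RePart z - RePart (w :: 'a complexification)"
  "ImPart (z - w) = ImPart z - ImPart (w :: 'a complexification)"
  "RePart (- z) = - RePart (z :: 'a complexification)"
  "ImPart (- z) = - ImPart (z :: 'a complexification)"
  "RePart (r *\<^sub>R z) = r *\<^sub>R RePart (z :: 'a complexification)"
  "ImPart (r *\<^sub>R z) = r *\<^sub>R ImPart (z :: 'a complexification)"
  "RePart (c *\<^sub>C z) = Re c *\<^sub>R RePart z - Im c *\<^sub>R ImPart (z :: 'a complexification)"
  "ImPart (c *\<^sub>C z) = Im c *\<^sub>R RePart z + Re c *\<^sub>R ImPart (z :: 'a complexification)"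
  by (simp_all add: complexification_ops)

lemma norm_scaleC_le: "norm (c *\<^sub>C z) \<le> cmod c * norm (z :: 'a complexification)"
proof -
  have "norm (c *\<^sub>C z) \<le> norm (cmod c *\<^sub>R modulus (RePart z) (ImPart z))"
    unfolding norm_complexification_def complexification_sel
    by (rule norm_mono_nonneg[OF modulus_nonneg modulus_scaleC_le])
  then show ?thesis by (simp add: norm_complexification_def)
qed

lemma norm_scaleC_eq: "norm (c *\<^sub>C z) = cmod c * norm (z :: 'a complexification)"
proof (cases "c = 0")
  case True
  have "0 \<le> norm z" by (simp add: norm_complexification_def)
  with norm_scaleC_le[of c z] True show ?thesis
    by (auto simp: norm_complexification_def intro: antisym)
next
  case False
  have "inverse c *\<^sub>C c *\<^sub>C z = z"
  proof (rule complexification.expand)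
    have "Re (inverse c) * Re c - Im (inverse c) * Im c = 1"
         "Im (inverse c) * Re c + Re (inverse c) * Im c = 0"
      using arg_cong[OF left_inverse[OF False], of Re] arg_cong[OF left_inverse[OF False], of Im]
      by (simp_all del: left_inverse inverse_complex.simps add: algebra_simps)
    moreover have
      "RePart (inverse c *\<^sub>C c *\<^sub>C z) = (Re (inverse c) * Re c - Im (inverse c) * Im c) *\<^sub>R RePart z
         - (Im (inverse c) * Re c + Re (inverse c) * Im c) *\<^sub>R ImPart z"
      "ImPart (inverse c *\<^sub>C c *\<^sub>C z) = (Re (inverse c) * Re c - Im (inverse c) * Im c) *\<^sub>R ImPart z
         + (Im (inverse c) * Re c + Re (inverse c) * Im c) *\<^sub>R RePart z"
      by (simp_all del: inverse_complex.simps add: algebra_simps)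
    ultimately show "RePart (inverse c *\<^sub>C c *\<^sub>C z) = RePart z \<and> ImPart (inverse c *\<^sub>C c *\<^sub>C z) = ImPart z"
      by (simp del: inverse_complex.simps complexification_sel)
  qed
  then have "norm z \<le> cmod (inverse c) * norm (c *\<^sub>C z)"
    using norm_scaleC_le[of "inverse c" "c *\<^sub>C z"] by simp
  then have "cmod c * norm z \<le> cmod c * (cmod (inverse c) * norm (c *\<^sub>C z))"
    by (intro mult_left_mono) auto
  also have "\<dots> = norm (c *\<^sub>C z)"
    by (simp only: mult.assoc[symmetric] norm_mult[symmetric] right_inverse[OF False] norm_one mult_1)
  finally have "cmod c * norm z \<le> norm (c *\<^sub>C z)" .
  with norm_scaleC_le[of c z] show ?thesis by simp
qed

lemma norm_RePart_le: "norm (RePart z) \<le> norm (z :: 'a complexification)"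
  using modulus_ge1[of "RePart z" "ImPart z"]
  by (metis abs_ge_zero norm_abs_lattice norm_complexification_def norm_mono_nonneg)

lemma norm_ImPart_le: "norm (ImPart z) \<le> norm (z :: 'a complexification)"
  using modulus_ge2[of "ImPart z" "RePart z"]
  by (metis abs_ge_zero norm_abs_lattice norm_complexification_def norm_mono_nonneg)

lemma norm_complexification_le:
  "norm z \<le> norm (RePart z) + norm (ImPart (z :: 'a complexification))"
proof -
  have "norm z \<le> norm (\<bar>RePart z\<bar> + \<bar>ImPart z\<bar>)"
    unfolding norm_complexification_def by (rule norm_mono_nonneg[OF modulus_nonneg modulus_le])
  also have "\<dots> \<le> norm \<bar>RePart z\<bar> + norm \<bar>ImPart z\<bar>" by (rule norm_triangle_ineq)
  finally show ?thesis by (simp add: norm_abs_lattice)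
qed

instance
proof intro_classes
  fix z w v :: "'a complexification" and r s :: real
  fix U :: "'a complexification set"
  show "z + w + v = z + (w + v)" "z + w = w + z" "0 + z = z" "- z + z = 0" "z - w = z + - w"
    by (auto intro!: complexification.expand simp: algebra_simps)
  show "r *\<^sub>R (z + w) = r *\<^sub>R z + r *\<^sub>R w" "(r + s) *\<^sub>R z = r *\<^sub>R z + s *\<^sub>R z"
    "r *\<^sub>R s *\<^sub>R z = (r * s) *\<^sub>R z" "1 *\<^sub>R z = z"
    by (auto intro!: complexification.expand simp: algebra_simps)
  show "dist z w = norm (z - w)" by (rule dist_complexification_def)
  show "sgn z = inverse (norm z) *\<^sub>R z" by (rule sgn_complexification_def)
  show "(uniformity :: ('a complexification \<times> 'a complexification) filter) =
      (INF e\<in>{0 <..}. principal {(z, w). dist z w < e})"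
    by (rule uniformity_complexification_def)
  show "open U \<longleftrightarrow> (\<forall>z\<in>U. \<forall>\<^sub>F (z', w) in uniformity. z' = z \<longrightarrow> w \<in> U)"
    by (rule open_complexification_def)
  show "norm z = 0 \<longleftrightarrow> z = 0"
  proof
    assume "norm z = 0"
    with norm_RePart_le[of z] norm_ImPart_le[of z] show "z = 0"
      by (auto intro!: complexification.expand)
  qed (use norm_complexification_le[of z] in \<open>auto simp: norm_complexification_def modulus_real\<close>)
  show "norm (z + w) \<le> norm z + norm w"
    unfolding norm_complexification_def complexification_sel
    by (rule order_trans[OF norm_mono_nonneg[OF modulus_nonneg modulus_triangle] norm_triangle_ineq])
  show "norm (r *\<^sub>R z) = \<bar>r\<bar> * norm z"
  proof -
    have "complex_of_real r *\<^sub>C z = r *\<^sub>R z" by (auto intro!: complexification.expand)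
    then show ?thesis using norm_scaleC_eq[of "complex_of_real r" z] by simp
  qed
qed

end

instance complexification :: (real_banach_lattice) complex_banach
proof intro_classes
  fix z w :: "'a complexification" and r :: real and a b :: complex
  show "a *\<^sub>C (z + w) = a *\<^sub>C z + a *\<^sub>C w" "(a + b) *\<^sub>C z = a *\<^sub>C z + b *\<^sub>C z"
    "a *\<^sub>C b *\<^sub>C z = (a * b) *\<^sub>C z" "complex_of_real r *\<^sub>C z = r *\<^sub>R z"
    by (auto intro!: complexification.expand simp: algebra_simps)
  show "norm (a *\<^sub>C z) = cmod a * norm z" by (rule norm_scaleC_eq)
next
  fix X :: "nat \<Rightarrow> 'a complexification"
  assume C: "Cauchy X"
  have dR: "dist (RePart z) (RePart w) \<le> dist z w" and dI: "dist (ImPart z) (ImPart w) \<le> dist z w"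
    for z w :: "'a complexification"
    using norm_RePart_le[of "z - w"] norm_ImPart_le[of "z - w"] by (simp_all add: dist_norm)
  have Cauchy_image: "Cauchy (\<lambda>n. f (X n))"
    if f: "\<And>z w. dist (f z) (f w) \<le> dist z w" for f :: "'a complexification \<Rightarrow> 'a"
    by (rule metric_CauchyI) (meson C f metric_CauchyD le_less_trans)
  have "Cauchy (\<lambda>n. RePart (X n))" "Cauchy (\<lambda>n. ImPart (X n))"
    by (rule Cauchy_image, rule dR) (rule Cauchy_image, rule dI)
  then obtain x y where x: "(\<lambda>n. RePart (X n)) \<longlonglongrightarrow> x" and y: "(\<lambda>n. ImPart (X n)) \<longlonglongrightarrow> y"
    unfolding Cauchy_convergent_iff convergent_def by blast
  have lim: "(\<lambda>n. norm (RePart (X n) - x) + norm (ImPart (X n) - y)) \<longlonglongrightarrow> 0"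
    using tendsto_add[OF tendsto_norm_zero[OF LIM_zero[OF x]] tendsto_norm_zero[OF LIM_zero[OF y]]]
    by simp
  have le: "norm (dist (X n) (Cplx x y)) \<le> norm (RePart (X n) - x) + norm (ImPart (X n) - y)"
    for n
    using norm_complexification_le[of "X n - Cplx x y"] by (simp add: dist_norm)
  have "(\<lambda>n. dist (X n) (Cplx x y)) \<longlonglongrightarrow> 0"
    by (rule Lim_null_comparison[OF always_eventually[OF allI[OF le]] lim])
  then show "convergent X"
    using iffD2[OF tendsto_dist_iff] unfolding convergent_def by blast
qed

definition positive_cone :: "'a::real_banach_lattice complexification set"
  where "positive_cone = {Cplx x 0 | x. 0 \<le> x}"

definition positive_operator ::
    "('a::real_banach_lattice complexification \<Rightarrow> 'a complexification) \<Rightarrow> bool"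
  where "positive_operator S \<longleftrightarrow> (\<forall>z\<in>positive_cone. S z \<in> positive_cone)"

section \<open>Semigroups of operators\<close>

definition bounded_clinear :: "('b::complex_banach \<Rightarrow> 'b) \<Rightarrow> bool"
  where "bounded_clinear S \<longleftrightarrow> bounded_linear S \<and> (\<forall>c x. S (c *\<^sub>C x) = c *\<^sub>C S x)"

text \<open>
  A semigroup is a family indexed by the reals of which only the members with index
  \<open>t \<ge> 0\<close> matter.
\<close>
definition C0_semigroup :: "(real \<Rightarrow> 'b::complex_banach \<Rightarrow> 'b) \<Rightarrow> bool"
  where "C0_semigroup T \<longleftrightarrow>
    (\<forall>t\<ge>0. bounded_clinear (T t)) \<and>
    T 0 = id \<and>
    (\<forall>s\<ge>0. \<forall>t\<ge>0. T (s + t) = T s \<circ> T t) \<and>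
    (\<forall>x. ((\<lambda>t. T t x) \<longlongrightarrow> x) (at_right 0))"

definition generator_domain :: "(real \<Rightarrow> 'b::complex_banach \<Rightarrow> 'b) \<Rightarrow> 'b set"
  where "generator_domain T =
    {x. \<exists>y. ((\<lambda>h. (T h x - x) /\<^sub>R h) \<longlongrightarrow> y) (at_right 0)}"

definition generator :: "(real \<Rightarrow> 'b::complex_banach \<Rightarrow> 'b) \<Rightarrow> 'b \<Rightarrow> 'b"
  where "generator T x = Lim (at_right 0) (\<lambda>h. (T h x - x) /\<^sub>R h)"

text \<open>
  An unbounded operator is given by its domain \<open>D\<close> and a function \<open>A\<close> whose values
  outside \<open>D\<close> are irrelevant.
\<close>
definition resolvent :: "'b::complex_banach set \<Rightarrow> ('b \<Rightarrow> 'b) \<Rightarrow> complex \<Rightarrow> 'b \<Rightarrow> 'b"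
  where "resolvent D A \<mu> = inv_into D (\<lambda>x. \<mu> *\<^sub>C x - A x)"

definition resolvent_set :: "'b::complex_banach set \<Rightarrow> ('b \<Rightarrow> 'b) \<Rightarrow> complex set"
  where "resolvent_set D A =
    {\<mu>. bij_betw (\<lambda>x. \<mu> *\<^sub>C x - A x) D UNIV \<and> bounded_clinear (resolvent D A \<mu>)}"

text \<open>The operator \<open>A\<close> below is the negative of the generator.\<close>
definition Kreiss_bounded :: "(real \<Rightarrow> 'b::complex_banach \<Rightarrow> 'b) \<Rightarrow> bool"
  where "Kreiss_bounded T \<longleftrightarrow>
    (let D = generator_domain T; A = (\<lambda>x. - generator T x) in
      {\<mu>. Re \<mu> < 0} \<subseteq> resolvent_set D A \<and>
      (\<exists>C::real. \<forall>\<zeta>. 0 < Re \<zeta> \<longrightarrow> onorm (resolvent D A (- \<zeta>)) \<le> C / Re \<zeta>))"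

definition uniformly_eventually_positive ::
    "(real \<Rightarrow> 'a::real_banach_lattice complexification \<Rightarrow> 'a complexification) \<Rightarrow> bool"
  where "uniformly_eventually_positive T \<longleftrightarrow> (\<exists>t0\<ge>0. \<forall>t\<ge>t0. positive_operator (T t))"

end

theory Submission
  imports Defs
begin

text \<open>
  For \<open>x \<ge> 0\<close> positivity turns the Kreiss condition into the Cesaro bound
  \<open>\<parallel>\<Sum>\<^sub>i\<^sub><\<^sub>n P\<^sup>i x\<parallel> \<le> D n \<parallel>x\<parallel>\<close> for \<open>P = T\<^sub>\<tau>\<close>, because \<open>e\<^sup>-\<^sup>1\<close> times the integral of \<open>T\<^sub>t y\<close> over
  \<open>[0, s]\<close> lies below the resolvent \<open>(1/s - G)\<^sup>-\<^sup>1 y\<close>, and because in an AM-space the orbit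
  \<open>{T\<^sub>s P x | 0 \<le> s \<le> \<tau>}\<close>, being compact, has an upper bound of comparable norm. That the resolvent
  preserves the cone of vectors with positive orbit is clear near infinity and propagates to all of
  \<open>(0, \<infinity>)\<close> by Neumann series.

  In the dual AL-space the Cesaro bound says that \<open>f k = \<parallel>P'\<^sup>k \<phi>\<parallel>\<close> satisfies
  \<open>f k + \<dots> + f (k + n - 1) \<le> D n f k\<close>, a discrete differential inequality for the tail sums that
  forces \<open>f (N - 1) = O (N\<^bsup>1-\<epsilon>\<^esup>)\<close>. Here this is carried out without duality, replacing the test
  functional by suprema of elements of the unit ball.
\<close>

section \<open>Boundedness of semigroups\<close>

text \<open>Baire category: the closed sets \<open>F k\<close> cover the space, so one of them
  contains a ball. By linearity a common bound on a ball around any centre gives a common bound for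
  the operator norms.\<close>

lemma uniform_boundedness:
  fixes f :: "'i \<Rightarrow> 'a::banach \<Rightarrow> 'b::real_normed_vector"
  assumes lin: "\<And>i. bounded_linear (f i)"
    and bdd: "\<And>x. bounded (range (\<lambda>i. f i x))"
  shows "\<exists>M. \<forall>i. onorm (f i) \<le> M"
proof -
  define F where "F k = {x. \<forall>i. norm (f i x) \<le> real k}" for k
  have closedF: "closed (F k)" for k
  proof -
    have "F k = (\<Inter>i. {x. norm (f i x) \<le> real k})" by (auto simp: F_def)
    then show ?thesis
      using lin by (auto intro!: closed_INT closed_Collect_le continuous_intros
          simp: linear_continuous_on)
  qed
  have cover: "\<Union> (range F) = UNIV"
  proof -
    have "\<exists>k. x \<in> F k" for x
    proof -
      obtain b where b: "\<And>i. norm (f i x) \<le> b" using bdd[of x] by (auto simp: bounded_iff)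
      obtain k where "b \<le> real k" using real_arch_simple by blast
      then show ?thesis using b by (auto simp: F_def intro: order_trans)
    qed
    then show ?thesis by auto
  qed
  have "\<exists>k. interior (F k) \<noteq> {}"
  proof (rule ccontr)
    assume *: "\<not> ?thesis"
    have "euclidean interior_of \<Union> (range F) = {}"
      by (rule Baire_category_alt) (use * closedF completely_metrizable_space_euclidean in auto)
    with cover show False by simp
  qed
  then obtain k x0 where "x0 \<in> interior (F k)" by blast
  then obtain r where r: "r > 0" "cball x0 r \<subseteq> F k"
    by (meson mem_interior_cball)
  have "onorm (f i) \<le> 2 * real k / r" for i
  proof (rule onorm_bound)
    interpret bounded_linear "f i" by (rule lin)
    fix y
    show "norm (f i y) \<le> 2 * real k / r * norm y"
    proof (cases "y = 0")
      case False
      define v where "v = (r / norm y) *\<^sub>R y"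
      have "norm v = r" using False r by (simp add: v_def)
      then have "x0 + v \<in> F k" "x0 \<in> F k" using r by (auto simp: subset_iff dist_norm)
      then have "norm (f i (x0 + v)) \<le> real k" "norm (f i x0) \<le> real k" by (auto simp: F_def)
      moreover have "f i v = f i (x0 + v) - f i x0" by (simp add: add)
      ultimately have "norm (f i v) \<le> 2 * real k"
        using norm_triangle_ineq4[of "f i (x0 + v)" "f i x0"] by simp
      then show ?thesis using r False by (simp add: v_def scaleR field_simps)
    qed (simp add: zero)
  qed (use r in auto)
  then show ?thesis by blast
qed

locale c0_semigroup =
  fixes T :: "real \<Rightarrow> 'b::complex_banach \<Rightarrow> 'b"
  assumes C0: "C0_semigroup T"
begin

lemma bounded_linear_T: "0 \<le> t \<Longrightarrow> bounded_linear (T t)"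
  using C0 by (simp add: C0_semigroup_def bounded_clinear_def)

lemma T_0 [simp]: "T 0 x = x"
  using C0 by (simp add: C0_semigroup_def)

lemma T_add: "0 \<le> s \<Longrightarrow> 0 \<le> t \<Longrightarrow> T (s + t) x = T s (T t x)"
  using C0 by (simp add: C0_semigroup_def)

lemma T_funpow: "0 \<le> s \<Longrightarrow> T (real n * s) x = (T s ^^ n) x"
  by (induction n) (auto simp: distrib_right T_add)

lemma T_lim_0: "((\<lambda>t. T t x) \<longlongrightarrow> x) (at_right 0)"
  using C0 by (simp add: C0_semigroup_def)

text \<open>Otherwise there are times \<open>t n > 0\<close> tending to \<open>0\<close> along which
  the operator norms are unbounded. Strong continuity at \<open>0\<close> bounds every orbit along
  these times, which contradicts \<open>uniform_boundedness\<close>.\<close>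

lemma locally_bounded: "\<exists>\<delta>>0. \<exists>M\<ge>1. \<forall>t\<in>{0..\<delta>}. \<forall>x. norm (T t x) \<le> M * norm x"
proof (rule ccontr)
  assume neg: "\<not> ?thesis"
  have "\<exists>t. 0 < t \<and> t \<le> 1 / real (Suc n) \<and> real (Suc n) < onorm (T t)" for n
  proof (rule ccontr)
    assume *: "\<not> ?thesis"
    have "norm (T t x) \<le> real (Suc n) * norm x" if t: "t \<in> {0..1 / real (Suc n)}" for t x
    proof (cases "t = 0")
      case True
      have "1 * norm x \<le> real (Suc n) * norm x" by (intro mult_right_mono) auto
      with True show ?thesis by simp
    next
      case False
      then have "onorm (T t) \<le> real (Suc n)" using * t by force
      then show ?thesis
        using onorm[OF bounded_linear_T, of t x] t mult_right_mono[of _ _ "norm x"]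
        by (meson atLeastAtMost_iff norm_ge_zero order_trans)
    qed
    moreover have "0 < 1 / real (Suc n)" "1 \<le> real (Suc n)" by auto
    ultimately show False using neg by blast
  qed
  then obtain t where t: "\<And>n. 0 < t n" "\<And>n. t n \<le> 1 / real (Suc n)"
    "\<And>n. real (Suc n) < onorm (T (t n))" by metis
  have "t \<longlonglongrightarrow> 0"
    by (rule real_tendsto_sandwich[OF _ _ tendsto_const LIMSEQ_inverse_real_of_nat])
      (use t in \<open>auto simp: inverse_eq_divide less_imp_le\<close>)
  then have t0: "filterlim t (at_right 0) sequentially"
    using t(1) t(1)[THEN less_imp_neq, THEN not_sym] by (simp add: filterlim_at)
  have "bounded (range (\<lambda>n. T (t n) x))" for x
    using filterlim_compose[OF T_lim_0 t0, of x] by (intro convergent_imp_bounded)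
  then have "\<exists>M. \<forall>n. onorm (T (t n)) \<le> M"
    using t(1) by (intro uniform_boundedness bounded_linear_T) (auto simp: less_imp_le)
  then obtain M where M: "\<And>n. onorm (T (t n)) \<le> M" by blast
  obtain n where "M \<le> real n" using real_arch_simple by blast
  then show False using M[of n] t(3)[of n] by auto
qed

text \<open>Cutting \<open>t\<close> into steps of length at most \<open>\<delta>\<close> multiplies
  the local bounds. The exponent is \<open>ln M / \<delta>\<close>, and the extra factor
  \<open>M\<close> pays for the incomplete step.\<close>

lemma exponentially_bounded:
  "\<exists>M\<ge>1. \<exists>\<omega>\<ge>0. \<forall>t\<ge>0. \<forall>x. norm (T t x) \<le> M * exp (\<omega> * t) * norm x"
proof -
  obtain \<delta> M where d: "\<delta> > 0" and M: "M \<ge> 1"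
    and b: "\<And>t x. 0 \<le> t \<Longrightarrow> t \<le> \<delta> \<Longrightarrow> norm (T t x) \<le> M * norm x"
    using locally_bounded by fastforce
  have pow: "norm (T t x) \<le> M ^ Suc n * norm x" if "0 \<le> t" "t \<le> real (Suc n) * \<delta>" for n t x
    using that
  proof (induction n arbitrary: t x)
    case 0
    then show ?case using b by simp
  next
    case (Suc n)
    show ?case
    proof (cases "t \<le> \<delta>")
      case True
      have "norm (T t x) \<le> M * norm x" using b Suc True by simp
      also have "\<dots> \<le> M ^ Suc (Suc n) * norm x"
        using M by (intro mult_right_mono) (auto intro: self_le_power[of M "Suc (Suc n)", simplified])
      finally show ?thesis .
    next
      case False
      have "T t x = T (t - \<delta>) (T \<delta> x)" using T_add[of "t - \<delta>" \<delta>] False d by simp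
      also have "norm \<dots> \<le> M ^ Suc n * norm (T \<delta> x)"
        using Suc.prems False by (intro Suc.IH) (auto simp: algebra_simps)
      also have "\<dots> \<le> M ^ Suc n * (M * norm x)"
        using M d by (intro mult_left_mono b) auto
      finally show ?thesis by (simp add: mult_ac)
    qed
  qed
  have "norm (T t x) \<le> M * exp (ln M / \<delta> * t) * norm x" if "0 \<le> t" for t x
  proof -
    define n where "n = nat \<lfloor>t / \<delta>\<rfloor>"
    have "0 \<le> t / \<delta>" using that d by simp
    then have n: "real n \<le> t / \<delta>" "t / \<delta> < real n + 1" unfolding n_def by linarith+
    then have "t \<le> real (Suc n) * \<delta>" using d by (simp add: field_simps)
    then have "norm (T t x) \<le> M ^ Suc n * norm x" using pow that by blast
    moreover have "M ^ n \<le> exp (ln M / \<delta> * t)"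
    proof -
      have "M ^ n = exp (ln M * real n)" using M by (simp add: exp_of_nat2_mult)
      also have "\<dots> \<le> exp (ln M * (t / \<delta>))" 
        using mult_left_mono[OF n(1), of "ln M"] M by simp
      finally show ?thesis by simp
    qed
    ultimately show ?thesis
      using M by (smt (verit) mult_left_mono mult_right_mono norm_ge_zero power_Suc)
  qed
  then show ?thesis using M d by (intro exI[of _ M] conjI exI[of _ "ln M / \<delta>"]) auto
qed

lemma bounded_on_interval:
  "\<exists>M\<ge>1. \<forall>t\<in>{0..a}. \<forall>x. norm (T t x) \<le> M * norm x"
proof -
  obtain M \<omega> where M: "M \<ge> 1" "\<omega> \<ge> 0"
    and b: "\<And>t x. 0 \<le> t \<Longrightarrow> norm (T t x) \<le> M * exp (\<omega> * t) * norm x"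
    using exponentially_bounded by blast
  show ?thesis
  proof (intro exI[of _ "M * exp (\<omega> * \<bar>a\<bar>)"] conjI ballI allI)
    show "1 \<le> M * exp (\<omega> * \<bar>a\<bar>)" using M mult_mono[of 1 M 1 "exp (\<omega> * \<bar>a\<bar>)"] by simp
    fix t x assume t: "t \<in> {0..a}"
    have "norm (T t x) \<le> M * exp (\<omega> * t) * norm x" using t b by simp
    also have "\<dots> \<le> M * exp (\<omega> * \<bar>a\<bar>) * norm x"
      using t M by (intro mult_right_mono mult_left_mono) (auto intro: mult_left_mono)
    finally show "norm (T t x) \<le> M * exp (\<omega> * \<bar>a\<bar>) * norm x" .
  qed
qed

text \<open>Only right continuity at \<open>0\<close> is assumed. Factoring out \<open>T\<close> at
  the smaller of two times reduces both one-sided limits to it, the uniform bound on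
  \<open>{0..a}\<close> controlling the factor.\<close>

lemma continuous_on_orbit: "continuous_on {0..a} (\<lambda>t. T t x)"
proof -
  obtain M where M: "M \<ge> 1" and b: "\<And>t y. t \<in> {0..a} \<Longrightarrow> norm (T t y) \<le> M * norm y"
    using bounded_on_interval[of a] by blast
  have key: "norm (T t x - T s x) \<le> M * norm (T (t - s) x - x)" if "0 \<le> s" "s \<le> t" "t \<le> a" for s t
  proof -
    interpret bounded_linear "T s" using that by (intro bounded_linear_T)
    have "T t x = T s (T (t - s) x)" using T_add[of s "t - s"] that by simp
    then have "T t x - T s x = T s (T (t - s) x - x)" by (simp add: diff)
    also have "norm \<dots> \<le> M * norm (T (t - s) x - x)" using that by (intro b) auto
    finally show ?thesis .
  qed
  show ?thesis unfolding continuous_on_iff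
  proof (intro ballI allI impI)
    fix t e :: real assume t: "t \<in> {0..a}" and e: "0 < e"
    have "\<forall>\<^sub>F h in at_right 0. dist (T h x) x < e / M"
      using tendstoD[OF T_lim_0[of x], of "e / M"] e M by simp
    then obtain d where d: "d > 0" "\<And>h. 0 < h \<Longrightarrow> h < d \<Longrightarrow> dist (T h x) x < e / M"
      by (auto simp: eventually_at_right_field)
    have d': "M * norm (T h x - x) < e" if "0 \<le> h" "h < d" for h
      using d(2)[of h] that e M by (cases "h = 0") (auto simp: dist_norm field_simps)
    have "dist (T s x) (T t x) < e" if s: "s \<in> {0..a}" "dist s t < d" for s
    proof (cases "s \<le> t")
      case True
      then show ?thesis using key[of s t] d'[of "t - s"] s t
        by (simp add: dist_norm norm_minus_commute)
    next
      case False
      then show ?thesis using key[of t s] d'[of "s - t"] s t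
        by (simp add: dist_norm)
    qed
    then show "\<exists>d>0. \<forall>s\<in>{0..a}. dist s t < d \<longrightarrow> dist (T s x) (T t x) < e" using d(1) by blast
  qed
qed

text \<open>
  If \<open>u = (\<mu> - G)\<^sup>-\<^sup>1 y\<close>, then \<open>u - e\<^bsup>-\<mu>a\<^esup> T\<^sub>a u\<close> is the integral of \<open>e\<^bsup>-\<mu>t\<^esup> T\<^sub>t y\<close> over
  \<open>[0, a]\<close>; Riemann sums are all that is needed of it.
\<close>

lemma riemann_sums:
  fixes \<mu> a :: real
  assumes a: "0 < a"
    and G: "((\<lambda>h. (T h u - u) /\<^sub>R h) \<longlongrightarrow> \<mu> *\<^sub>R u - y) (at_right 0)"
  shows "(\<lambda>n. \<Sum>j<Suc n. (a / Suc n) *\<^sub>R exp (- \<mu> * (j * (a / Suc n))) *\<^sub>R T (j * (a / Suc n)) y)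
    \<longlonglongrightarrow> u - exp (- \<mu> * a) *\<^sub>R T a u"
proof -
  obtain M where M: "M \<ge> 1" and b: "\<And>t y. t \<in> {0..a} \<Longrightarrow> norm (T t y) \<le> M * norm y"
    using bounded_on_interval[of a] by blast
  \<comment> \<open>\<open>E\<close> is again a semigroup, with generator \<open>G - \<mu>\<close>.
    The hypothesis on \<open>u\<close> says \<open>(\<mu> - G) u = y\<close>, which reappears below
    as convergence of \<open>q h\<close> to \<open>y\<close>.\<close>
  define E where "E t x = exp (- \<mu> * t) *\<^sub>R T t x" for t x
  define L where "L = M * exp (\<bar>\<mu>\<bar> * a)"
  have linE: "bounded_linear (E t)" if "0 \<le> t" for t
    unfolding E_def using bounded_linear_T[OF that]
    by (intro bounded_linear_const_scaleR)
  have E_add: "E (s + t) x = E s (E t x)" if "0 \<le> s" "0 \<le> t" for s t x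
  proof -
    interpret bounded_linear "T s" using that by (intro bounded_linear_T)
    show ?thesis using that
      by (simp add: E_def T_add scaleR exp_add[symmetric] algebra_simps)
  qed
  have E_bound: "norm (E t x) \<le> L * norm x" if "t \<in> {0..a}" for t x
  proof -
    have "- \<mu> * t \<le> \<bar>\<mu>\<bar> * a"
      using that by (smt (verit) atLeastAtMost_iff mult_mono mult_minus_left abs_ge_zero mult_right_mono)
    then have "norm (E t x) \<le> exp (\<bar>\<mu>\<bar> * a) * (M * norm x)"
      unfolding E_def using that b by (auto intro!: mult_mono)
    then show ?thesis by (simp add: L_def mult_ac)
  qed
  define q where "q h = (u - E h u) /\<^sub>R h" for h
  have q: "(q \<longlongrightarrow> y) (at_right 0)"
  proof -
    have "((\<lambda>h. - (exp (- \<mu> * h) *\<^sub>R ((T h u - u) /\<^sub>R h)) + ((1 - exp (- \<mu> * h)) / h) *\<^sub>R u)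
        \<longlongrightarrow> - (1 *\<^sub>R (\<mu> *\<^sub>R u - y)) + \<mu> *\<^sub>R u) (at_right 0)"
    proof (intro tendsto_add tendsto_minus tendsto_scaleR G tendsto_const)
      show "((\<lambda>h. exp (- \<mu> * h)) \<longlongrightarrow> 1) (at_right 0)"
        by (rule tendsto_eq_intros refl | simp)+
      have "((\<lambda>h. exp (- \<mu> * h)) has_real_derivative - \<mu>) (at 0)"
        by (auto intro!: derivative_eq_intros)
      then have "((\<lambda>h. (exp (- \<mu> * h) - 1) / h) \<longlongrightarrow> - \<mu>) (at 0)"
        by (simp add: DERIV_def)
      then have "((\<lambda>h. - ((exp (- \<mu> * h) - 1) / h)) \<longlongrightarrow> - (- \<mu>)) (at_right 0)"
        by (intro tendsto_minus) (simp add: filterlim_at_split)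
      then show "((\<lambda>h. (1 - exp (- \<mu> * h)) / h) \<longlongrightarrow> \<mu>) (at_right 0)"
        by (simp add: diff_divide_distrib)
    qed
    moreover have "- (exp (- \<mu> * h) *\<^sub>R ((T h u - u) /\<^sub>R h)) + ((1 - exp (- \<mu> * h)) / h) *\<^sub>R u = q h" for h
      by (simp add: q_def E_def divide_inverse algebra_simps)
    ultimately show ?thesis by simp
  qed
  define h where "h n = a / real (Suc n)" for n
  have h_pos: "h n > 0" for n using a by (simp add: h_def)
  have "(\<lambda>n. a * inverse (real (Suc n))) \<longlonglongrightarrow> a * 0"
    by (intro tendsto_mult tendsto_const LIMSEQ_inverse_real_of_nat)
  then have "h \<longlonglongrightarrow> 0" by (simp add: h_def[abs_def] divide_inverse)
  then have h0: "filterlim h (at_right 0) sequentially"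
    using h_pos h_pos[THEN less_imp_neq, THEN not_sym] by (simp add: filterlim_at)
  define R where "R n = (\<Sum>j<Suc n. h n *\<^sub>R E (real j * h n) y)" for n
  have err: "norm (R n - (u - E a u)) \<le> a * L * norm (y - q (h n))" for n
  proof -
    have j: "real j * h n \<in> {0..a}" if "j < Suc n" for j
    proof -
      have "real j * h n \<le> real (Suc n) * h n"
        using that h_pos[of n] by (intro mult_right_mono) auto
      also have "\<dots> = a" by (simp add: h_def)
      finally show ?thesis using h_pos[of n] by simp
    qed
    \<comment> \<open>Telescoping makes \<open>u - E a u\<close> exactly the Riemann sum with
      \<open>q (h n)\<close> in place of \<open>y\<close>, so the error is governed by
      \<open>y - q (h n)\<close>.\<close>
    have "u - E a u = (\<Sum>j<Suc n. E (real j * h n) u - E (real (Suc j) * h n) u)"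
      using sum_lessThan_telescope'[of "\<lambda>j. E (real j * h n) u" "Suc n"]
      by (simp add: E_def h_def del: sum.lessThan_Suc of_nat_Suc)
    also have "\<dots> = (\<Sum>j<Suc n. h n *\<^sub>R E (real j * h n) (q (h n)))"
    proof (rule sum.cong[OF refl])
      fix j
      have nn: "0 \<le> real j * h n" using h_pos[of n] by simp
      interpret bounded_linear "E (real j * h n)" using nn by (rule linE)
      have "E (real (Suc j) * h n) u = E (real j * h n) (E (h n) u)"
        using E_add[OF nn, of "h n"] h_pos[of n] by (simp add: algebra_simps)
      then show "E (real j * h n) u - E (real (Suc j) * h n) u = h n *\<^sub>R E (real j * h n) (q (h n))"
        using h_pos[of n] by (simp add: q_def scaleR diff)
    qed
    finally have "R n - (u - E a u) = (\<Sum>j<Suc n. h n *\<^sub>R (E (real j * h n) (y - q (h n))))"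
      unfolding R_def using h_pos[of n]
      by (simp only: sum_subtractf[symmetric] scaleR_diff_right[symmetric])
        (intro sum.cong refl, simp add: bounded_linear.linear linear_diff linE)
    also have "norm \<dots> \<le> (\<Sum>j<Suc n. h n * (L * norm (y - q (h n))))"
      using j h_pos[of n] by (intro sum_norm_le) (auto intro!: mult_left_mono E_bound)
    also have "\<dots> = a * L * norm (y - q (h n))" using a by (simp add: h_def)
    finally show ?thesis .
  qed
  have "(\<lambda>n. a * L * norm (y - q (h n))) \<longlonglongrightarrow> a * L * norm (y - y)"
    by (intro tendsto_intros filterlim_compose[OF q h0])
  then have "(\<lambda>n. R n - (u - E a u)) \<longlonglongrightarrow> 0"
    by (intro Lim_null_comparison[OF always_eventually[OF allI[OF err]]]) simp
  then have "R \<longlonglongrightarrow> u - E a u" by (simp add: LIM_zero_iff)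
  then show ?thesis by (simp add: R_def[abs_def] E_def h_def)
qed

end

section \<open>Resolvents and invariant cones\<close>

lemma convex_cone_sum:
  assumes "convex_cone K" "\<And>i. i \<in> I \<Longrightarrow> f i \<in> K"
  shows "sum f I \<in> K"
  using assms(2) by (induction I rule: infinite_finite_induct)
    (simp_all add: convex_cone_add[OF assms(1)] convex_cone_contains_0[OF assms(1)])

text \<open>\<open>R \<mu>\<close> is the resolvent \<open>(\<mu> - G)\<^sup>-\<^sup>1\<close> of the generator \<open>G\<close>, characterised without domains.\<close>

locale kreiss_semigroup = c0_semigroup T
  for T :: "real \<Rightarrow> 'b::complex_banach \<Rightarrow> 'b" +
  fixes C :: real and R :: "real \<Rightarrow> 'b \<Rightarrow> 'b"
  assumes C_ge_1: "1 \<le> C"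
    and linear_R: "0 < \<mu> \<Longrightarrow> linear (R \<mu>)"
    and norm_R: "0 < \<mu> \<Longrightarrow> norm (R \<mu> y) \<le> C / \<mu> * norm y"
    and R_eq_iff: "0 < \<mu> \<Longrightarrow>
      R \<mu> y = u \<longleftrightarrow> ((\<lambda>h. (T h u - u) /\<^sub>R h) \<longlongrightarrow> \<mu> *\<^sub>R u - y) (at_right 0)"
begin

text \<open>In the order given by \<open>K\<close>, a lower bound \<open>w\<close> of the integrand
  yields the lower bound \<open>a *\<^sub>R w\<close> of the integral: this holds for each Riemann
  sum, and \<open>K\<close> is closed. The case \<open>w = 0\<close> gives invariance, other
  \<open>w\<close> give quantitative estimates.\<close>

lemma resolvent_increment:
  assumes K: "closed K" "convex_cone K" and \<mu>: "0 < \<mu>" and a: "0 < a"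
    and ge: "\<And>t. 0 \<le> t \<Longrightarrow> t \<le> a \<Longrightarrow> exp (- \<mu> * t) *\<^sub>R T t y - w \<in> K"
  shows "R \<mu> y - exp (- \<mu> * a) *\<^sub>R T a (R \<mu> y) - a *\<^sub>R w \<in> K"
proof (rule closed_sequentially[OF K(1)])
  define g where "g n j = (a / Suc n) *\<^sub>R exp (- \<mu> * (j * (a / Suc n))) *\<^sub>R T (j * (a / Suc n)) y"
    for n j :: nat
  have G: "((\<lambda>h. (T h (R \<mu> y) - R \<mu> y) /\<^sub>R h) \<longlongrightarrow> \<mu> *\<^sub>R R \<mu> y - y) (at_right 0)"
    using R_eq_iff[OF \<mu>, of y "R \<mu> y"] by simp
  show "(\<lambda>n. (\<Sum>j<Suc n. g n j) - a *\<^sub>R w) \<longlonglongrightarrow> R \<mu> y - exp (- \<mu> * a) *\<^sub>R T a (R \<mu> y) - a *\<^sub>R w"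
    unfolding g_def by (intro tendsto_diff[OF _ tendsto_const] riemann_sums a G)
  have "g n j - (a / Suc n) *\<^sub>R w \<in> K" if j: "j < Suc n" for n j
  proof -
    have "real j * (a / Suc n) \<le> real (Suc n) * (a / Suc n)"
      using j a by (intro mult_right_mono) auto
    then have "exp (- \<mu> * (j * (a / Suc n))) *\<^sub>R T (j * (a / Suc n)) y - w \<in> K"
      using a by (intro ge) auto
    from convex_cone_scaleR[OF K(2) _ this, of "a / Suc n"] show ?thesis
      using a by (simp add: g_def scaleR_diff_right)
  qed
  then have in_K: "(\<Sum>j<Suc n. g n j - (a / Suc n) *\<^sub>R w) \<in> K" for n
    by (intro convex_cone_sum[OF K(2)]) auto
  have eq: "(\<Sum>j<Suc n. g n j - (a / Suc n) *\<^sub>R w) = (\<Sum>j<Suc n. g n j) - a *\<^sub>R w" for n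
    by (simp add: sum_subtractf sum_constant_scaleR del: sum.lessThan_Suc of_nat_Suc)
  show "(\<Sum>j<Suc n. g n j) - a *\<^sub>R w \<in> K" for n
    using in_K[of n] unfolding eq .
qed

text \<open>Take \<open>w = 0\<close> in \<open>resolvent_increment\<close> and let \<open>a\<close>
  tend to infinity: for \<open>\<mu>\<close> beyond the growth exponent the term with
  \<open>T a\<close> vanishes in the limit.\<close>

lemma resolvent_invariant_large:
  "\<exists>\<mu>0>0. \<forall>\<mu>\<ge>\<mu>0. \<forall>K. closed K \<longrightarrow> convex_cone K \<longrightarrow> (\<forall>t\<ge>0. \<forall>y\<in>K. T t y \<in> K) \<longrightarrow>
    (\<forall>y\<in>K. R \<mu> y \<in> K)"
proof -
  obtain M \<omega> where M: "M \<ge> 1" "\<omega> \<ge> 0"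
    and b: "\<And>t x. 0 \<le> t \<Longrightarrow> norm (T t x) \<le> M * exp (\<omega> * t) * norm x"
    using exponentially_bounded by blast
  have "R \<mu> y \<in> K" if \<mu>: "\<omega> + 1 \<le> \<mu>" and K: "closed K" "convex_cone K"
    and inv: "\<forall>t\<ge>0. \<forall>y\<in>K. T t y \<in> K" and y: "y \<in> K" for \<mu> K y
  proof (rule closed_sequentially[OF K(1)])
    define u where "u = R \<mu> y"
    define v where "v n = exp (- \<mu> * real (Suc n)) *\<^sub>R T (real (Suc n)) u" for n
    have v_bound: "norm (v n) \<le> M * norm u * exp (- real n)" for n
    proof -
      have "norm (v n) \<le> exp (- \<mu> * real (Suc n)) * (M * exp (\<omega> * real (Suc n)) * norm u)"
        unfolding v_def
        using b[of "real (Suc n)" u] by (simp add: mult_left_mono del: of_nat_Suc)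
      also have "\<dots> = M * norm u * (exp (- \<mu> * real (Suc n)) * exp (\<omega> * real (Suc n)))"
        by (simp only: mult_ac)
      also have "\<dots> = M * norm u * exp (- \<mu> * real (Suc n) + \<omega> * real (Suc n))"
        by (simp only: exp_add)
      also have "- \<mu> * real (Suc n) + \<omega> * real (Suc n) = (\<omega> - \<mu>) * real (Suc n)"
        by (simp only: left_diff_distrib mult_minus_left)
      also have "(\<omega> - \<mu>) * real (Suc n) \<le> - 1 * real (Suc n)"
        using \<mu> by (intro mult_right_mono) auto
      then have "M * norm u * exp ((\<omega> - \<mu>) * real (Suc n)) \<le> M * norm u * exp (- real n)"
        using M by (intro mult_left_mono) auto
      finally show ?thesis .
    qed
    have "(\<lambda>n. M * norm u * exp (- 1) ^ n) \<longlonglongrightarrow> M * norm u * 0"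
      by (intro tendsto_mult tendsto_const LIMSEQ_realpow_zero) auto
    then have "(\<lambda>n. M * norm u * exp (- real n)) \<longlonglongrightarrow> 0"
      by (simp add: exp_of_nat_mult[symmetric])
    then have "v \<longlonglongrightarrow> 0"
      by (rule Lim_null_comparison[OF always_eventually[OF allI[OF v_bound]]])
    from tendsto_diff[OF tendsto_const this] show "(\<lambda>n. u - v n) \<longlonglongrightarrow> R \<mu> y"
      by (simp add: u_def)
    have "u - v n - real (Suc n) *\<^sub>R 0 \<in> K" for n
      unfolding u_def v_def
    proof (rule resolvent_increment[OF K])
      show "exp (- \<mu> * t) *\<^sub>R T t y - 0 \<in> K" if "0 \<le> t" for t
        using inv y that by (simp add: convex_cone_scaleR[OF K(2)])
    qed (use \<mu> M(2) in auto)
    then show "u - v n \<in> K" for n by simp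
  qed
  moreover have "0 < \<omega> + 1" using M(2) by simp
  ultimately show ?thesis by blast
qed

text \<open>
  By the resolvent identity \<open>R \<nu> y\<close> is the fixed point of \<open>z \<mapsto> R \<mu> (y + (\<mu> - \<nu>) z)\<close>. This is
  a contraction with constant \<open>1/2\<close>, and preserves \<open>K\<close> if \<open>R \<mu>\<close> does.
\<close>

lemma resolvent_invariant_step:
  assumes K: "closed K" "convex_cone K" and \<mu>: "0 < \<mu>"
    and inv: "\<And>y. y \<in> K \<Longrightarrow> R \<mu> y \<in> K" and y: "y \<in> K"
  shows "R ((1 - 1 / (2 * C)) * \<mu>) y \<in> K"
proof (rule closed_sequentially[OF K(1)])
  \<comment> \<open>This makes \<open>\<mu> - \<nu> = \<mu> / (2 * C)\<close>, which against the
    bound \<open>C / \<mu>\<close> from \<open>norm_R\<close> leaves the contraction constant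
    \<open>1/2\<close>.\<close>
  define \<nu> where "\<nu> = (1 - 1 / (2 * C)) * \<mu>"
  have "1 / (2 * C) \<le> 1 / 2" using C_ge_1 by (simp add: field_simps)
  then have \<nu>: "0 < \<nu>" unfolding \<nu>_def using \<mu> by (intro mult_pos_pos) auto
  have diff: "\<mu> - \<nu> = \<mu> / (2 * C)" by (simp add: \<nu>_def left_diff_distrib)
  define r where "r = R \<nu> y"
  have "((\<lambda>h. (T h r - r) /\<^sub>R h) \<longlongrightarrow> \<nu> *\<^sub>R r - y) (at_right 0)"
    using R_eq_iff[OF \<nu>, of y r] by (simp add: r_def)
  also have "\<nu> *\<^sub>R r - y = \<mu> *\<^sub>R r - (y + (\<mu> - \<nu>) *\<^sub>R r)" by (simp add: algebra_simps)
  finally have r: "R \<mu> (y + (\<mu> - \<nu>) *\<^sub>R r) = r" using R_eq_iff[OF \<mu>] by simp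
  define z where "z k = ((\<lambda>z. R \<mu> (y + (\<mu> - \<nu>) *\<^sub>R z)) ^^ k) 0" for k
  have nn: "0 \<le> \<mu> - \<nu>" using diff \<mu> C_ge_1 by simp
  have z_Suc: "z (Suc k) = R \<mu> (y + (\<mu> - \<nu>) *\<^sub>R z k)" for k by (simp add: z_def)
  show "z k \<in> K" for k
  proof (induction k)
    case (Suc k)
    then show ?case unfolding z_Suc
      by (intro inv convex_cone_add[OF K(2) y] convex_cone_scaleR[OF K(2) nn])
  qed (simp add: z_def convex_cone_contains_0 K)
  have bound: "norm (z k - r) \<le> (1/2) ^ k * norm r" for k
  proof (induction k)
    case (Suc k)
    have "z (Suc k) - r = R \<mu> (y + (\<mu> - \<nu>) *\<^sub>R z k) - R \<mu> (y + (\<mu> - \<nu>) *\<^sub>R r)"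
      unfolding r z_Suc ..
    also have "\<dots> = R \<mu> ((\<mu> - \<nu>) *\<^sub>R (z k - r))"
      by (simp add: linear_diff[OF linear_R[OF \<mu>], symmetric] scaleR_diff_right)
    also have "norm \<dots> \<le> C / \<mu> * norm ((\<mu> - \<nu>) *\<^sub>R (z k - r))" by (rule norm_R[OF \<mu>])
    also have "\<dots> = 1/2 * norm (z k - r)" using \<mu> C_ge_1 by (simp add: diff)
    also have "\<dots> \<le> 1/2 * ((1/2) ^ k * norm r)" using Suc by simp
    finally show ?case by simp
  qed (simp add: z_def)
  have "(\<lambda>k. (1/2) ^ k * norm r) \<longlonglongrightarrow> 0 * norm r"
    by (intro tendsto_mult tendsto_const LIMSEQ_realpow_zero) auto
  then have "(\<lambda>k. z k - r) \<longlonglongrightarrow> 0"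
    by (intro Lim_null_comparison[OF always_eventually[OF allI[OF bound]]]) simp
  then show "z \<longlonglongrightarrow> R ((1 - 1 / (2 * C)) * \<mu>) y"
    by (simp add: LIM_zero_iff r_def \<nu>_def)
qed

text \<open>Each step lowers \<open>\<mu>\<close> by the same factor \<open>q < 1\<close>, because
  the Kreiss bound scales like \<open>1 / \<mu>\<close>. Finitely many steps therefore lead from the
  large parameters to any positive one.\<close>

lemma resolvent_invariant:
  assumes K: "closed K" "convex_cone K" and inv: "\<And>t y. 0 \<le> t \<Longrightarrow> y \<in> K \<Longrightarrow> T t y \<in> K"
    and \<mu>: "0 < \<mu>" and y: "y \<in> K"
  shows "R \<mu> y \<in> K"
proof -
  obtain \<mu>0 where \<mu>0: "0 < \<mu>0" and large: "\<And>\<mu> y. \<mu>0 \<le> \<mu> \<Longrightarrow> y \<in> K \<Longrightarrow> R \<mu> y \<in> K"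
    using resolvent_invariant_large K inv by metis
  define q where "q = 1 - 1 / (2 * C)"
  have q: "0 < q" "q < 1" using C_ge_1 by (auto simp: q_def field_simps)
  have *: "R \<mu> y \<in> K" if "\<mu>0 * q ^ n \<le> \<mu>" "y \<in> K" for n \<mu> y
    using that
  proof (induction n arbitrary: \<mu> y)
    case (Suc n)
    then have le: "\<mu>0 * q ^ n \<le> \<mu> / q" using q by (simp add: field_simps)
    moreover have "0 < \<mu>0 * q ^ n" using \<mu>0 q by simp
    ultimately have "0 < \<mu> / q" by linarith
    then have "R (q * (\<mu> / q)) y \<in> K"
      unfolding q_def[symmetric] using resolvent_invariant_step[OF K, of "\<mu> / q" y] Suc.IH[OF le] Suc.prems(2)
      by (simp add: q_def)
    then show ?case using q by simp
  qed (use large in simp)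
  have "(\<lambda>n. \<mu>0 * q ^ n) \<longlonglongrightarrow> \<mu>0 * 0"
    using q by (intro tendsto_mult tendsto_const LIMSEQ_realpow_zero) auto
  then have "\<forall>\<^sub>F n in sequentially. \<mu>0 * q ^ n < \<mu>" using \<mu> by (intro order_tendstoD(2)) auto
  then obtain n where "\<mu>0 * q ^ n < \<mu>" by (auto simp: eventually_sequentially)
  then show ?thesis using * y by (meson less_imp_le)
qed

end

section \<open>From unbounded operators with domains to the abstract resolvent\<close>

lemma inv_into_eq_iff:
  assumes "bij_betw f D UNIV"
  shows "inv_into D f y = x \<longleftrightarrow> x \<in> D \<and> f x = y"
  using bij_betw_inv_into_left[OF assms] bij_betw_inv_into_right[OF assms]
    bij_betwE[OF bij_betw_inv_into[OF assms]] by blast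

text \<open>The signs come from \<open>A = - G\<close>: the resolvent of \<open>A\<close> at
  \<open>- \<mu>\<close> is \<open>(- \<mu> + G)\<close> inverted, so its value at
  \<open>- y\<close> is the solution \<open>u\<close> of \<open>(\<mu> - G) u = y\<close>. Only real
  parameters are retained.\<close>

lemma kreiss_semigroupI:
  fixes T :: "real \<Rightarrow> 'b::complex_banach \<Rightarrow> 'b"
  assumes "C0_semigroup T" "Kreiss_bounded T"
  shows "\<exists>C R. kreiss_semigroup T C R"
proof -
  interpret c0_semigroup T by standard fact
  define D where "D = generator_domain T"
  define A where "A x = - generator T x" for x
  obtain C0 where res: "\<And>\<zeta>. Re \<zeta> < 0 \<Longrightarrow> \<zeta> \<in> resolvent_set D A"
    and C0: "\<And>\<zeta>. 0 < Re \<zeta> \<Longrightarrow> onorm (resolvent D A (- \<zeta>)) \<le> C0 / Re \<zeta>"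
    using assms(2) unfolding Kreiss_bounded_def Let_def D_def A_def[abs_def] by blast
  \<comment> \<open>A constant of at least \<open>1\<close> keeps the factor
    \<open>1 - 1 / (2 * C)\<close> used for lowering the parameter positive.\<close>
  define C where "C = max 1 C0"
  define Q where "Q \<mu> = resolvent D A (- complex_of_real \<mu>)" for \<mu>
  have scaleC: "(- complex_of_real \<mu>) *\<^sub>C x = - (\<mu> *\<^sub>R x)" for \<mu> and x :: 'b
    using scaleC_of_real[of "- \<mu>" x] by simp
  have bij: "bij_betw (\<lambda>x. - (\<mu> *\<^sub>R x) + generator T x) D UNIV" and linQ: "bounded_linear (Q \<mu>)"
    if "0 < \<mu>" for \<mu>
    using res[of "- complex_of_real \<mu>"] that
    by (auto simp: resolvent_set_def scaleC A_def Q_def bounded_clinear_def)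
  have gen: "x \<in> D \<and> generator T x = y \<longleftrightarrow> ((\<lambda>h. (T h x - x) /\<^sub>R h) \<longlongrightarrow> y) (at_right 0)" for x y
    unfolding D_def generator_domain_def generator_def
  proof
    assume "x \<in> {x. \<exists>y. ((\<lambda>h. (T h x - x) /\<^sub>R h) \<longlongrightarrow> y) (at_right 0)} \<and>
      Lim (at_right 0) (\<lambda>h. (T h x - x) /\<^sub>R h) = y"
    then obtain y' where "((\<lambda>h. (T h x - x) /\<^sub>R h) \<longlongrightarrow> y') (at_right 0)"
      and "Lim (at_right 0) (\<lambda>h. (T h x - x) /\<^sub>R h) = y" by blast
    then show "((\<lambda>h. (T h x - x) /\<^sub>R h) \<longlongrightarrow> y) (at_right 0)"
      using tendsto_Lim[OF trivial_limit_at_right_real] by metis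
  qed (use tendsto_Lim[OF trivial_limit_at_right_real] in auto)
  have "kreiss_semigroup T C (\<lambda>\<mu> y. Q \<mu> (- y))"
  proof (intro kreiss_semigroup.intro kreiss_semigroup_axioms.intro)
    show "c0_semigroup T" by standard (rule assms(1))
    show "1 \<le> C" by (simp add: C_def)
  next
    fix \<mu> :: real assume \<mu>: "0 < \<mu>"
    interpret Q: bounded_linear "Q \<mu>" using linQ[OF \<mu>] .
    show "linear (\<lambda>y. Q \<mu> (- y))"
    proof (rule linearI)
      show "Q \<mu> (- (x + y)) = Q \<mu> (- x) + Q \<mu> (- y)" for x y
        using Q.add[of "- x" "- y"] by simp
      show "Q \<mu> (- (r *\<^sub>R x)) = r *\<^sub>R Q \<mu> (- x)" for r x
        using Q.scaleR[of r "- x"] by simp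
    qed
    fix y
    have "norm (Q \<mu> (- y)) \<le> onorm (Q \<mu>) * norm y" using onorm[OF linQ[OF \<mu>], of "- y"] by simp
    also have "\<dots> \<le> C0 / \<mu> * norm y"
      using C0[of "complex_of_real \<mu>"] \<mu> by (intro mult_right_mono) (auto simp: Q_def)
    also have "\<dots> \<le> C / \<mu> * norm y"
      using \<mu> by (intro mult_right_mono divide_right_mono) (auto simp: C_def)
    finally show "norm (Q \<mu> (- y)) \<le> C / \<mu> * norm y" .
    fix u
    have Q_def': "Q \<mu> = inv_into D (\<lambda>x. - (\<mu> *\<^sub>R x) + generator T x)"
      by (simp add: Q_def resolvent_def scaleC A_def)
    have "Q \<mu> (- y) = u \<longleftrightarrow> u \<in> D \<and> - (\<mu> *\<^sub>R u) + generator T u = - y"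
      unfolding Q_def' by (rule inv_into_eq_iff[OF bij[OF \<mu>]])
    also have "\<dots> \<longleftrightarrow> u \<in> D \<and> generator T u = \<mu> *\<^sub>R u - y"
      by (auto simp: algebra_simps eq_neg_iff_add_eq_0)
    also have "\<dots> \<longleftrightarrow> ((\<lambda>h. (T h u - u) /\<^sub>R h) \<longlongrightarrow> \<mu> *\<^sub>R u - y) (at_right 0)" by (rule gen)
    finally show "Q \<mu> (- y) = u \<longleftrightarrow> ((\<lambda>h. (T h u - u) /\<^sub>R h) \<longlongrightarrow> \<mu> *\<^sub>R u - y) (at_right 0)" .
  qed
  then show ?thesis by blast
qed

section \<open>Cesaro bounded positive operators on AM-spaces\<close>

lemma compact_finite_net:
  fixes A :: "'a::metric_space set"
  assumes "compact A" "0 < e"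
  shows "\<exists>F\<subseteq>A. finite F \<and> (\<forall>a\<in>A. \<exists>b\<in>F. dist a b < e)"
proof -
  have "A \<subseteq> (\<Union>b\<in>A. ball b e)" using assms(2) by auto
  from compactE_image[OF assms(1) _ this] obtain F where "F \<subseteq> A" "finite F" "A \<subseteq> (\<Union>b\<in>F. ball b e)"
    by auto
  moreover have "\<exists>b\<in>F. dist a b < e" if a: "a \<in> A" for a
  proof -
    obtain b where "b \<in> F" "a \<in> ball b e"
      using \<open>A \<subseteq> (\<Union>b\<in>F. ball b e)\<close> a by blast
    then show ?thesis by (auto simp: dist_commute)
  qed
  ultimately show ?thesis by blast
qed

text \<open>The AM identity iterates, so the bound does not depend on the number of elements. This
  is what lets finite nets of growing size be controlled.\<close>

lemma norm_Sup_fin_le: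
  fixes F :: "'a::real_am_space set"
  assumes "finite F" "F \<noteq> {}" "\<And>x. x \<in> F \<Longrightarrow> 0 \<le> x" "\<And>x. x \<in> F \<Longrightarrow> norm x \<le> M"
  shows "norm (Sup_fin F) \<le> M"
proof -
  have "0 \<le> Sup_fin F \<and> norm (Sup_fin F) \<le> M" using assms
  proof (induction F rule: finite_ne_induct)
    case (insert x F)
    then show ?case by (auto simp: norm_sup_eq_max intro: le_supI1)
  qed auto
  then show ?thesis ..
qed

text \<open>
  Suprema of increasing finite nets form a Cauchy sequence: enlarging a \<open>2\<^sup>-\<^sup>n\<close>-net raises the
  supremum by at most the supremum of finitely many elements of norm \<open>2\<^sup>-\<^sup>n\<close>, which in an AM-space
  has norm at most \<open>2\<^sup>-\<^sup>n\<close> as well.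
\<close>

lemma compact_bounded_above:
  fixes A :: "'a::real_am_space set"
  assumes A: "compact A" "A \<noteq> {}" and nonneg: "\<And>x. x \<in> A \<Longrightarrow> 0 \<le> x"
    and M: "\<And>x. x \<in> A \<Longrightarrow> norm x \<le> M"
  shows "\<exists>z. (\<forall>x\<in>A. x \<le> z) \<and> norm z \<le> M"
proof -
  define e :: "nat \<Rightarrow> real" where "e n = (1/2) ^ n" for n
  have "\<exists>F\<subseteq>A. finite F \<and> (\<forall>a\<in>A. \<exists>b\<in>F. dist a b < e n)" for n
    using A by (intro compact_finite_net) (auto simp: e_def)
  then obtain F where F: "\<And>n. F n \<subseteq> A" "\<And>n. finite (F n)"
    "\<And>n a. a \<in> A \<Longrightarrow> \<exists>b\<in>F n. dist a b < e n" by metis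
  define G where "G n = (\<Union>k\<le>n. F k)" for n
  have G: "G n \<subseteq> A" "finite (G n)" "G n \<noteq> {}" for n
  proof -
    show "G n \<subseteq> A" "finite (G n)" using F(1,2) by (auto simp: G_def)
    obtain a where "a \<in> A" using A(2) by blast
    with F(3)[of a n] show "G n \<noteq> {}" by (auto simp: G_def)
  qed
  have G_mono: "G m \<subseteq> G n" if "m \<le> n" for m n
    unfolding G_def using that by (intro UN_mono) auto
  define s where "s n = Sup_fin (G n)" for n
  have s_ge: "b \<le> s n" if "b \<in> G n" for b n
    unfolding s_def using G that by (intro Sup_fin.coboundedI)
  have excess: "norm (sup (a - s n) 0) \<le> e n" if a: "a \<in> A" for a n
  proof -
    obtain b where b: "b \<in> F n" "dist a b < e n" using F(3)[OF a] by blast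
    then have "b \<le> s n" by (intro s_ge) (auto simp: G_def)
    then have "a - s n \<le> \<bar>a - b\<bar>" by (intro order_trans[OF _ abs_ge_self]) simp
    then have "sup (a - s n) 0 \<le> \<bar>a - b\<bar>"
      by simp
    then have "norm (sup (a - s n) 0) \<le> norm \<bar>a - b\<bar>"
      by (intro norm_mono_nonneg) auto
    with b(2) show ?thesis by (simp add: norm_abs_lattice dist_norm)
  qed
  have step: "norm (s m - s n) \<le> e n" if "n \<le> m" for m n
  proof -
    define g where "g = Sup_fin ((\<lambda>a. sup (a - s n) 0) ` G m)"
    have g: "norm g \<le> e n" unfolding g_def
      using G(2,3) excess[OF subsetD[OF G(1)]] by (intro norm_Sup_fin_le) auto
    have "a \<le> s n + g" if "a \<in> G m" for a
    proof -
      have "a - s n \<le> sup (a - s n) 0" by simp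
      also have "\<dots> \<le> g" unfolding g_def using G that by (intro Sup_fin.coboundedI) auto
      finally show ?thesis by (simp add: algebra_simps)
    qed
    then have "s m \<le> s n + g" unfolding s_def[of m] using G by (intro Sup_fin.boundedI) auto
    moreover have "s n \<le> s m"
      unfolding s_def using G G_mono[OF that] by (intro Sup_fin.subset_imp) auto
    ultimately have "norm (s m - s n) \<le> norm g"
      by (intro norm_mono_nonneg) (auto simp: algebra_simps)
    with g show ?thesis by simp
  qed
  have e0: "e \<longlonglongrightarrow> 0" unfolding e_def by (intro LIMSEQ_realpow_zero) auto
  have "Cauchy s"
  proof (rule CauchyI')
    fix r :: real assume "0 < r"
    then obtain N where N: "e N < r / 2"
      using order_tendstoD(2)[OF e0, of "r / 2"] by (auto simp: eventually_sequentially)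
    show "\<exists>N. \<forall>m\<ge>N. \<forall>n>m. dist (s m) (s n) < r"
    proof (intro exI[of _ N] allI impI)
      fix m n assume "N \<le> m" "m < n"
      then show "dist (s m) (s n) < r"
        using step[of N m] step[of N n] N dist_triangle2[of "s m" "s n" "s N"]
        by (simp add: dist_norm)
    qed
  qed
  then obtain z where z: "s \<longlonglongrightarrow> z" by (auto simp: Cauchy_convergent_iff convergent_def)
  have "norm (s n) \<le> M" for n
    unfolding s_def using G(2,3) nonneg[OF subsetD[OF G(1)]] M[OF subsetD[OF G(1)]] by (intro norm_Sup_fin_le)
  then have "norm z \<le> M"
    by (intro LIMSEQ_le_const2[OF tendsto_norm[OF z]]) auto
  moreover have "a \<le> z" if a: "a \<in> A" for a
  proof (rule lattice_limit_le[OF tendsto_const])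
    \<comment> \<open>No net need contain \<open>a\<close>. The positive part of
      \<open>a - s n\<close> closes the gap and tends to zero.\<close>
    have "(\<lambda>n. sup (a - s n) 0) \<longlonglongrightarrow> 0"
      by (rule Lim_null_comparison[OF always_eventually[OF allI[OF excess[OF a]]] e0])
    from tendsto_add[OF z this] show "(\<lambda>n. s n + sup (a - s n) 0) \<longlonglongrightarrow> z" by simp
    show "a \<le> s n + sup (a - s n) 0" for n
      by (metis add.commute diff_le_eq sup_ge1)
  qed
  ultimately show ?thesis by blast
qed

section \<open>A power gain from Cesaro bounds\<close>

lemma Suc_powr_le:
  fixes \<epsilon> :: real
  assumes "0 \<le> \<epsilon>" "\<epsilon> \<le> 1/2" "0 < n"
  shows "real (Suc n) powr \<epsilon> \<le> (1 + 2 * \<epsilon> / real n) * real n powr \<epsilon>"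
proof -
  have "ln (1 + 1 / real n) \<le> 1 / real n" by (rule ln_add_one_self_le_self) simp
  then have "(1 + 1 / real n) powr \<epsilon> \<le> exp (\<epsilon> * (1 / real n))"
    using assms mult_left_mono[of "ln (1 + 1 / real n)" "1 / real n" \<epsilon>] by (simp add: powr_def add_pos_pos)
  \<comment> \<open>On \<open>[0, 1/2]\<close> the exponential of \<open>s\<close> is at most
    \<open>1 + 2 * s\<close>; this is the origin of the factor \<open>2\<close>.\<close>
  also have "\<epsilon> * (1 / real n) \<le> 1/2 * 1" using assms by (intro mult_mono) auto
  then have "exp (\<epsilon> * (1 / real n)) \<le> 1 + 2 * (\<epsilon> * (1 / real n))"
    using assms by (intro real_exp_bound_lemma) auto
  finally have *: "(1 + 1 / real n) powr \<epsilon> \<le> 1 + 2 * \<epsilon> / real n" by simp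
  have "real (Suc n) = (1 + 1 / real n) * real n" using assms by (simp add: field_simps)
  then have "real (Suc n) powr \<epsilon> = (1 + 1 / real n) powr \<epsilon> * real n powr \<epsilon>"
    using assms by (simp add: powr_mult)
  then show ?thesis using * by (simp add: mult_right_mono)
qed

text \<open>
  With \<open>y\<^sub>n\<^sub>+\<^sub>1\<close> the supremum of \<open>y\<^sub>n\<close> and of its ergodic sum divided by \<open>C (n + 1)\<close>, the new bottom
  term \<open>P\<^sup>k y\<^sub>n\<^sub>+\<^sub>1\<close> alone dominates \<open>1 / (C (n + 1))\<close> times the previous sum, and the norm does
  not grow. Multiplying the gains gives the power \<open>n\<^sup>\<epsilon>\<close>.
\<close>

lemma orbit_le_sum:
  fixes P :: "'a::real_am_space \<Rightarrow> 'a"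
  assumes lin: "linear P" and pos: "\<And>x. 0 \<le> x \<Longrightarrow> 0 \<le> P x" and C: "1 \<le> C"
    and cesaro: "\<And>n x. 0 \<le> x \<Longrightarrow> norm (\<Sum>i<n. (P ^^ i) x) \<le> C * real n * norm x"
    and x: "0 \<le> x"
  shows "0 < n \<Longrightarrow> n \<le> N \<Longrightarrow> \<exists>y\<ge>0. norm y \<le> norm x \<and>
    (real n powr (1 / (4 * C))) *\<^sub>R (P ^^ (N - 1)) x \<le> (\<Sum>i\<in>{N - n..<N}. (P ^^ i) y)"
proof (induction n)
  case (Suc n)
  have linpow: "linear (P ^^ i)" for i
    by (induction i) (auto simp: id_def linear_id[unfolded id_def] comp_def
        intro: linear_compose[OF _ lin, unfolded comp_def])
  have pospow: "0 \<le> (P ^^ i) y" if "0 \<le> y" for i y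
    using that by (induction i) (auto intro: pos)
  have monopow: "(P ^^ i) y \<le> (P ^^ i) z" if "y \<le> z" for i y z
    using pospow[of "z - y" i] that by (simp add: linear_diff[OF linpow])
  define \<epsilon> where "\<epsilon> = 1 / (4 * C)"
  have \<epsilon>: "0 \<le> \<epsilon>" "\<epsilon> \<le> 1/2" using C by (auto simp: \<epsilon>_def field_simps)
  show ?case
  \<comment> \<open>The window of indices ends at \<open>N - 1\<close> and grows downwards. It
    begins as the single index \<open>N - 1\<close>, with \<open>y = x\<close> and gain
    \<open>1\<close>.\<close>
  proof (cases "n = 0")
    case True
    then have "{N - Suc n..<N} = {N - 1}" using Suc.prems by auto
    then show ?thesis using x True by (intro exI[of _ x]) auto
  next
    case False
    then obtain y where y: "0 \<le> y" "norm y \<le> norm x"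
      and le: "(real n powr \<epsilon>) *\<^sub>R (P ^^ (N - 1)) x \<le> (\<Sum>i\<in>{N - n..<N}. (P ^^ i) y)"
      using Suc by (auto simp: \<epsilon>_def)
    define m where "m = N - Suc n"
    define K where "K = C * real (Suc n)"
    have K: "0 < K" using C by (simp add: K_def)
    \<comment> \<open>Dividing by \<open>K\<close> makes the Cesaro hypothesis read
      \<open>norm v \<le> norm y\<close>, so by the AM property the supremum \<open>w\<close> costs
      nothing in norm.\<close>
    define v where "v = (\<Sum>j<Suc n. (P ^^ j) y) /\<^sub>R K"
    define w where "w = sup y v"
    define Z where "Z = (\<Sum>i\<in>{N - n..<N}. (P ^^ i) y)"
    have v: "0 \<le> v" unfolding v_def using K y by (intro scaleR_nonneg_nonneg sum_nonneg pospow) auto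
    have "norm v \<le> norm y"
      using cesaro[OF y(1), of "Suc n"] K by (simp add: v_def K_def field_simps del: sum.lessThan_Suc)
    then have w: "0 \<le> w" "norm w \<le> norm x"
      using y v by (auto simp: w_def norm_sup_eq_max intro: le_supI1)
    have Z: "0 \<le> Z" unfolding Z_def using y by (intro sum_nonneg pospow)
    have mN: "N = m + Suc n" "N - n = Suc m" using Suc.prems by (auto simp: m_def)
    \<comment> \<open>Applying \<open>P ^^ m\<close> moves the averaged indices to
      \<open>{m..<N}\<close>, that is, to the new bottom index together with the old window.\<close>
    have "(P ^^ m) v = (\<Sum>j<Suc n. (P ^^ (m + j)) y) /\<^sub>R K"
      unfolding v_def linear_scale[OF linpow] linear_sum[OF linpow] by (simp add: funpow_add)
    also have "(\<Sum>j<Suc n. (P ^^ (m + j)) y) = (\<Sum>i\<in>{m..<N}. (P ^^ i) y)"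
      unfolding mN using sum.shift_bounds_nat_ivl[of "\<lambda>i. (P ^^ i) y" 0 m "Suc n"]
      by (simp add: lessThan_atLeast0 add.commute del: sum.op_ivl_Suc)
    also have "\<dots> = (P ^^ m) y + Z"
      unfolding Z_def mN(2) using mN(1) by (intro sum.atLeast_Suc_lessThan) simp
    finally have "Z /\<^sub>R K \<le> (P ^^ m) v"
      using K pospow[OF y(1), of m] scaleR_nonneg_nonneg[of "inverse K" "(P ^^ m) y"]
      by (simp add: scaleR_add_right)
    also have "\<dots> \<le> (P ^^ m) w" by (intro monopow) (simp add: w_def)
    finally have bottom: "Z /\<^sub>R K \<le> (P ^^ m) w" .
    have "Z \<le> (\<Sum>i\<in>{Suc m..<N}. (P ^^ i) w)"
      unfolding Z_def mN(2) by (intro sum_mono monopow) (simp add: w_def)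
    moreover have "(\<Sum>i\<in>{m..<N}. (P ^^ i) w) = (P ^^ m) w + (\<Sum>i\<in>{Suc m..<N}. (P ^^ i) w)"
      using mN(1) by (intro sum.atLeast_Suc_lessThan) simp
    ultimately have "Z /\<^sub>R K + Z \<le> (\<Sum>i\<in>{m..<N}. (P ^^ i) w)"
      using add_mono[OF bottom] by simp
    moreover have "(real (Suc n) powr \<epsilon>) *\<^sub>R (P ^^ (N - 1)) x \<le> Z /\<^sub>R K + Z"
    proof -
      \<comment> \<open>The target power grows by a factor of at most
        \<open>1 + 2 * \<epsilon> / n\<close>, the window by \<open>1 + 1 / K\<close>. With
        \<open>\<epsilon> = 1 / (4 * C)\<close> the latter suffices, because
        \<open>n + 1 \<le> 2 * n\<close>.\<close>
      have "2 * \<epsilon> / real n \<le> inverse K"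
      proof -
        have "2 * \<epsilon> / real n = 1 / (C * (2 * real n))" by (simp add: \<epsilon>_def)
        also have "\<dots> \<le> 1 / (C * real (Suc n))"
          using C False by (intro divide_left_mono mult_left_mono mult_pos_pos) auto
        finally show ?thesis by (simp add: K_def inverse_eq_divide)
      qed
      then have "1 + 2 * \<epsilon> / real n \<le> inverse K + 1" by simp
      then have "real (Suc n) powr \<epsilon> \<le> (inverse K + 1) * real n powr \<epsilon>"
        using Suc_powr_le[OF \<epsilon>, of n] False
        by (meson gr0I mult_right_mono order_trans powr_ge_zero)
      then have "(real (Suc n) powr \<epsilon>) *\<^sub>R (P ^^ (N - 1)) x
          \<le> ((inverse K + 1) * real n powr \<epsilon>) *\<^sub>R (P ^^ (N - 1)) x"
        by (intro scaleR_right_mono pospow x)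
      also have "\<dots> \<le> (inverse K + 1) *\<^sub>R Z"
        using scaleR_left_mono[OF le, of "inverse K + 1"] K by (simp add: Z_def)
      finally show ?thesis by (simp add: scaleR_add_left)
    qed
    ultimately show ?thesis using w by (intro exI[of _ w]) (auto simp: \<epsilon>_def m_def)
  qed
qed simp

text \<open>For \<open>N = Suc n\<close> the full window is the range of an ergodic sum, which the
  Cesaro bound caps linearly in \<open>Suc n\<close>. Dividing by the gain leaves the exponent
  \<open>1 - 1 / (4 * C)\<close>.\<close>

lemma Cesaro_bounded_growth:
  fixes P :: "'a::real_am_space \<Rightarrow> 'a"
  assumes lin: "linear P" and pos: "\<And>x. 0 \<le> x \<Longrightarrow> 0 \<le> P x" and C: "1 \<le> C"
    and cesaro: "\<And>n x. 0 \<le> x \<Longrightarrow> norm (\<Sum>i<n. (P ^^ i) x) \<le> C * real n * norm x"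
    and x: "0 \<le> x"
  shows "norm ((P ^^ n) x) \<le> C * real (Suc n) powr (1 - 1 / (4 * C)) * norm x"
proof -
  define r where "r = real (Suc n) powr (1 / (4 * C))"
  have r: "0 < r" by (simp add: r_def)
  obtain y where y: "0 \<le> y" "norm y \<le> norm x" and le: "r *\<^sub>R (P ^^ n) x \<le> (\<Sum>i<Suc n. (P ^^ i) y)"
    using orbit_le_sum[OF lin pos C cesaro x, of "Suc n" "Suc n"]
    by (auto simp: r_def lessThan_atLeast0)
  have "0 \<le> (P ^^ n) x" using x by (induction n) (auto intro: pos)
  then have "norm (r *\<^sub>R (P ^^ n) x) \<le> norm (\<Sum>i<Suc n. (P ^^ i) y)"
    using r le by (intro norm_mono_nonneg) (auto intro: scaleR_nonneg_nonneg)
  also have "\<dots> \<le> C * real (Suc n) * norm y" by (rule cesaro[OF y(1)])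
  also have "\<dots> \<le> C * real (Suc n) * norm x" using y C by (intro mult_left_mono) auto
  finally have "norm ((P ^^ n) x) \<le> C * (real (Suc n) / r) * norm x"
    using r by (simp add: field_simps)
  then show ?thesis by (simp add: r_def powr_diff)
qed

section \<open>Positive operators on the complexification\<close>

lemma positive_cone_iff: "z \<in> positive_cone \<longleftrightarrow> 0 \<le> RePart z \<and> ImPart z = 0"
  by (cases z) (auto simp: positive_cone_def)

lemma Cplx_in_positive_cone [simp]: "Cplx x 0 \<in> positive_cone \<longleftrightarrow> 0 \<le> x"
  by (simp add: positive_cone_iff)

lemma Cplx_RePart: "z \<in> positive_cone \<Longrightarrow> Cplx (RePart z) 0 = z"
  by (cases z) (simp add: positive_cone_iff)

lemma norm_Cplx_0: "norm (Cplx x 0) = norm x"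
  by (simp add: norm_complexification_def modulus_real norm_abs_lattice)

lemma bounded_linear_RePart: "bounded_linear RePart"
  by (rule bounded_linear_intro[of _ 1]) (auto simp: norm_RePart_le)

lemma bounded_linear_ImPart: "bounded_linear ImPart"
  by (rule bounded_linear_intro[of _ 1]) (auto simp: norm_ImPart_le)

lemma linear_Cplx_0: "linear (\<lambda>x. Cplx x 0)"
  by (rule linearI) (auto intro: complexification.expand)

lemma convex_cone_positive_cone: "convex_cone positive_cone"
  by (auto simp: convex_cone_iff positive_cone_iff scaleR_nonneg_nonneg)

lemma closed_positive_cone: "closed (positive_cone :: 'a::real_banach_lattice complexification set)"
  unfolding closed_sequential_limits
proof (intro allI impI, elim conjE)
  fix X and z :: "'a complexification"
  assume X: "\<forall>n. X n \<in> positive_cone" and lim: "X \<longlonglongrightarrow> z"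
  have "0 \<le> RePart z"
    by (rule nonneg_limit[OF bounded_linear.tendsto[OF bounded_linear_RePart lim]])
      (use X in \<open>simp add: positive_cone_iff\<close>)
  moreover have "(\<lambda>n. ImPart (X n)) = (\<lambda>n. 0)" using X by (simp add: positive_cone_iff)
  then have "ImPart z = 0"
    using bounded_linear.tendsto[OF bounded_linear_ImPart lim] LIMSEQ_const_iff by metis
  ultimately show "z \<in> positive_cone" by (simp add: positive_cone_iff)
qed

lemma norm_mono_positive_cone:
  assumes a: "a \<in> positive_cone" and ba: "b - a \<in> positive_cone"
  shows "norm a \<le> norm b"
proof -
  have "b \<in> positive_cone" using convex_cone_add[OF convex_cone_positive_cone a ba] by simp
  moreover have "norm (RePart a) \<le> norm (RePart b)"
    using a ba by (intro norm_mono_nonneg) (auto simp: positive_cone_iff)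
  ultimately show ?thesis using Cplx_RePart[OF a] Cplx_RePart norm_Cplx_0 by metis
qed

text \<open>The four comes from the positive and negative parts of the real and imaginary parts,
  each of norm at most \<open>norm z\<close>.\<close>

lemma norm_le_4_positive:
  assumes S: "bounded_clinear S" and B: "0 \<le> B"
    and b: "\<And>x. 0 \<le> x \<Longrightarrow> norm (S (Cplx x 0)) \<le> B * norm x"
  shows "norm (S z) \<le> 4 * B * norm (z :: 'a::real_banach_lattice complexification)"
proof -
  interpret bounded_linear S using S by (simp add: bounded_clinear_def)
  have real: "norm (S (Cplx a 0)) \<le> 2 * B * norm a" for a :: 'a
  proof -
    have "pprt a \<le> \<bar>a\<bar>" "- nprt a \<le> \<bar>a\<bar>" by (simp_all add: abs_prts)
    then have p: "norm (pprt a) \<le> norm a" and n: "norm (- nprt a) \<le> norm a"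
      using norm_mono_nonneg[of "pprt a"] norm_mono_nonneg[of "- nprt a"]
      by (metis norm_abs_lattice zero_le_pprt, metis neg_0_le_iff_le norm_abs_lattice nprt_le_zero)
    have "Cplx a 0 = Cplx (pprt a) 0 - Cplx (- nprt a) 0"
      using prts[of a] by (auto intro: complexification.expand)
    then have "norm (S (Cplx a 0)) \<le> norm (S (Cplx (pprt a) 0)) + norm (S (Cplx (- nprt a) 0))"
      by (simp only: diff norm_triangle_ineq4)
    also have "\<dots> \<le> B * norm (pprt a) + B * norm (- nprt a)"
      by (intro add_mono b) auto
    also have "\<dots> \<le> B * norm a + B * norm a" using B p n by (intro add_mono mult_left_mono)
    finally show ?thesis by simp
  qed
  have "z = Cplx (RePart z) 0 + \<i> *\<^sub>C Cplx (ImPart z) 0"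
    by (auto intro: complexification.expand)
  then have "S z = S (Cplx (RePart z) 0) + \<i> *\<^sub>C S (Cplx (ImPart z) 0)"
    using S by (metis add bounded_clinear_def)
  then have "norm (S z) \<le> norm (S (Cplx (RePart z) 0)) + norm (S (Cplx (ImPart z) 0))"
    by (metis norm_triangle_ineq norm_scaleC norm_ii mult_1)
  also have "\<dots> \<le> 2 * B * norm (RePart z) + 2 * B * norm (ImPart z)" by (intro add_mono real)
  also have "\<dots> \<le> 2 * B * norm z + 2 * B * norm z"
    using B by (intro add_mono mult_left_mono norm_RePart_le norm_ImPart_le) auto
  finally show ?thesis by simp
qed

section \<open>Growth of eventually positive semigroups\<close>

text \<open>Here \<open>\<tau>\<close> is both the time from which positivity holds and the sampling
  step, hence bounded away from zero.\<close>

locale eventually_positive_kreiss = kreiss_semigroup T C R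
  for T :: "real \<Rightarrow> 'a::real_am_space complexification \<Rightarrow> 'a complexification" and C R +
  fixes \<tau> :: real
  assumes \<tau>_ge_1: "1 \<le> \<tau>"
    and positive: "\<tau> \<le> t \<Longrightarrow> z \<in> positive_cone \<Longrightarrow> T t z \<in> positive_cone"
begin

text \<open>The positive cone is known to be invariant only from time \<open>\<tau>\<close> on. This
  smaller cone is invariant at all times, as \<open>resolvent_invariant\<close> requires, and
  contains \<open>T t z\<close> for positive \<open>z\<close> and
  \<open>t \<ge> \<tau>\<close>.\<close>

definition K :: "'a complexification set"
  where "K = {y. \<forall>t\<ge>0. T t y \<in> positive_cone}"

lemma K_subset: "y \<in> K \<Longrightarrow> y \<in> positive_cone"
  using T_0[of y] by (force simp: K_def)

lemma T_K: "0 \<le> t \<Longrightarrow> y \<in> K \<Longrightarrow> T t y \<in> K"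
  by (auto simp: K_def T_add[symmetric])

lemma positive_in_K: "\<tau> \<le> t \<Longrightarrow> z \<in> positive_cone \<Longrightarrow> T t z \<in> K"
  using \<tau>_ge_1 by (auto simp: K_def T_add[symmetric] intro: positive)

lemma convex_cone_K: "convex_cone K"
  unfolding convex_cone_iff
proof (intro conjI ballI allI impI)
  show "0 \<in> K"
    by (auto simp: K_def bounded_linear_T bounded_linear.linear linear_0 positive_cone_iff)
  show "x + y \<in> K" if "x \<in> K" "y \<in> K" for x y
    using that by (auto simp: K_def bounded_linear_T bounded_linear.linear linear_add
        intro: convex_cone_add convex_cone_positive_cone)
  show "c *\<^sub>R x \<in> K" if "x \<in> K" "0 \<le> c" for x c
    using that by (auto simp: K_def bounded_linear_T bounded_linear.linear linear_scale
        intro: convex_cone_scaleR convex_cone_positive_cone)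
qed

lemma closed_K: "closed K"
  unfolding closed_sequential_limits
proof (intro allI impI, elim conjE)
  fix X z assume X: "\<forall>n. X n \<in> K" and lim: "X \<longlonglongrightarrow> z"
  have "T t z \<in> positive_cone" if "0 \<le> t" for t
    by (rule closed_sequentially[OF closed_positive_cone _
          bounded_linear.tendsto[OF bounded_linear_T lim]]) (use X that in \<open>auto simp: K_def\<close>)
  then show "z \<in> K" by (simp add: K_def)
qed

text \<open>Delaying the orbit by \<open>\<tau>\<close> makes it positive, so
  \<open>compact_bounded_above\<close> applies to its real parts. The square arises from bounding
  \<open>T s\<close> and \<open>T \<tau>\<close> in turn.\<close>

lemma orbit_upper_bound:
  assumes M: "\<And>t y. t \<in> {0..\<tau>} \<Longrightarrow> norm (T t y) \<le> M * norm y" "1 \<le> M" and x: "0 \<le> x"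
  shows "\<exists>z\<ge>0. norm z \<le> M\<^sup>2 * norm x \<and> (\<forall>s\<in>{0..\<tau>}. Cplx z 0 - T (s + \<tau>) (Cplx x 0) \<in> positive_cone)"
proof -
  define c where "c s = T s (T \<tau> (Cplx x 0))" for s
  have c_eq: "c s = T (s + \<tau>) (Cplx x 0)" if "0 \<le> s" for s
    using that \<tau>_ge_1 by (simp add: c_def T_add)
  have c_pos: "c s \<in> positive_cone" if "0 \<le> s" for s
    using that x by (simp add: c_eq positive)
  have "norm (c s) \<le> M\<^sup>2 * norm x" if s: "s \<in> {0..\<tau>}" for s
  proof -
    have "norm (c s) \<le> M * norm (T \<tau> (Cplx x 0))" unfolding c_def by (rule M(1)[OF s])
    also have "\<dots> \<le> M * (M * norm (Cplx x 0))"
      using M(2) \<tau>_ge_1 by (intro mult_left_mono M(1)) auto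
    finally show ?thesis by (simp add: norm_Cplx_0 power2_eq_square)
  qed
  moreover have "compact ((\<lambda>s. RePart (c s)) ` {0..\<tau>})"
    unfolding c_def
    by (intro compact_continuous_image continuous_on_orbit compact_Icc
        bounded_linear.continuous_on[OF bounded_linear_RePart])
  ultimately have "\<exists>z. (\<forall>y\<in>(\<lambda>s. RePart (c s)) ` {0..\<tau>}. y \<le> z) \<and> norm z \<le> M\<^sup>2 * norm x"
    using \<tau>_ge_1 c_pos
    by (intro compact_bounded_above)
      (auto simp: positive_cone_iff intro: order_trans[OF norm_RePart_le])
  then obtain z where "\<forall>y\<in>(\<lambda>s. RePart (c s)) ` {0..\<tau>}. y \<le> z" and z2: "norm z \<le> M\<^sup>2 * norm x"
    by blast
  then have z: "RePart (c s) \<le> z" if "s \<in> {0..\<tau>}" for s using that by blast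
  have "0 \<le> z" using z[of 0] c_pos[of 0] \<tau>_ge_1 by (auto simp: positive_cone_iff)
  moreover have "Cplx z 0 - c s \<in> positive_cone" if "s \<in> {0..\<tau>}" for s
    using z[OF that] c_pos[of s] that by (simp add: positive_cone_iff)
  ultimately show ?thesis using z2 by (auto simp: c_eq)
qed

text \<open>The integral behind the resolvent is cut into blocks of length \<open>\<tau>\<close>. On
  each block the integrand dominates, in the order of \<open>K\<close>, a fixed multiple of one
  sample of the orbit of \<open>x\<close>; the blocks telescope.\<close>

lemma weighted_sum_le_resolvent:
  assumes \<mu>: "0 < \<mu>" and z: "0 \<le> z"
    and up: "\<And>s. s \<in> {0..\<tau>} \<Longrightarrow> Cplx z 0 - T (s + \<tau>) (Cplx x 0) \<in> positive_cone"
  defines "u \<equiv> R \<mu> (T \<tau> (Cplx z 0))"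
  shows "u - exp (- \<mu> * (real n * \<tau>)) *\<^sub>R T (real n * \<tau>) u
    - (\<Sum>i<n. (\<tau> * exp (- \<mu> * (real (Suc i) * \<tau>))) *\<^sub>R T (real (i + 3) * \<tau>) (Cplx x 0)) \<in> K"
proof (induction n)
  case 0
  then show ?case by (simp add: convex_cone_contains_0 convex_cone_K)
next
  case (Suc n)
  define w where "w = exp (- \<mu> * \<tau>) *\<^sub>R T (3 * \<tau>) (Cplx x 0)"
  have y: "T \<tau> (Cplx z 0) \<in> K" using z by (intro positive_in_K) auto
  have "exp (- \<mu> * t) *\<^sub>R T t (T \<tau> (Cplx z 0)) - w \<in> K" if t: "0 \<le> t" "t \<le> \<tau>" for t
  proof -
    \<comment> \<open>The time \<open>\<tau> - t + \<tau>\<close> is chosen so that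
      \<open>T (t + \<tau>)\<close> brings the sample to time \<open>3 * \<tau>\<close> whatever
      \<open>t\<close> is. The summand \<open>\<tau>\<close> in \<open>t + \<tau>\<close> ensures
      that the result lies in \<open>K\<close>.\<close>
    define d where "d = Cplx z 0 - T (\<tau> - t + \<tau>) (Cplx x 0)"
    have "T (t + \<tau>) d \<in> K" unfolding d_def using t by (intro positive_in_K up) auto
    moreover have "T (t + \<tau>) d = T t (T \<tau> (Cplx z 0)) - T (3 * \<tau>) (Cplx x 0)"
      using t \<tau>_ge_1 T_add[of "t + \<tau>" "\<tau> - t + \<tau>" "Cplx x 0"]
      by (simp add: d_def T_add linear_diff bounded_linear_T bounded_linear.linear)
    ultimately have "exp (- \<mu> * \<tau>) *\<^sub>R (T t (T \<tau> (Cplx z 0)) - T (3 * \<tau>) (Cplx x 0)) \<in> K"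
      by (intro convex_cone_scaleR convex_cone_K) auto
    \<comment> \<open>Since \<open>t \<le> \<tau>\<close>, the weight can be lowered to its value at
      the end of the block, which makes the lower bound independent of \<open>t\<close>.\<close>
    moreover have "(exp (- \<mu> * t) - exp (- \<mu> * \<tau>)) *\<^sub>R T t (T \<tau> (Cplx z 0)) \<in> K"
      using t \<mu> by (intro convex_cone_scaleR convex_cone_K T_K[OF _ y]) auto
    ultimately have "(exp (- \<mu> * t) - exp (- \<mu> * \<tau>)) *\<^sub>R T t (T \<tau> (Cplx z 0)) +
        exp (- \<mu> * \<tau>) *\<^sub>R (T t (T \<tau> (Cplx z 0)) - T (3 * \<tau>) (Cplx x 0)) \<in> K"
      by (intro convex_cone_add convex_cone_K)
    then show ?thesis by (simp add: w_def algebra_simps)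
  qed
  then have one: "u - exp (- \<mu> * \<tau>) *\<^sub>R T \<tau> u - \<tau> *\<^sub>R w \<in> K"
    unfolding u_def using \<mu> \<tau>_ge_1 by (intro resolvent_increment closed_K convex_cone_K) auto
  define a where "a = real n * \<tau>"
  have a: "0 \<le> a" using \<tau>_ge_1 by (simp add: a_def)
  interpret Ta: bounded_linear "T a" by (rule bounded_linear_T[OF a])
  have "exp (- \<mu> * a) *\<^sub>R T a (u - exp (- \<mu> * \<tau>) *\<^sub>R T \<tau> u - \<tau> *\<^sub>R w) \<in> K"
    using one a by (intro convex_cone_scaleR convex_cone_K T_K) auto
  also have "exp (- \<mu> * a) *\<^sub>R T a (u - exp (- \<mu> * \<tau>) *\<^sub>R T \<tau> u - \<tau> *\<^sub>R w) =
      exp (- \<mu> * a) *\<^sub>R T a u - exp (- \<mu> * (a + \<tau>)) *\<^sub>R T (a + \<tau>) u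
      - (\<tau> * exp (- \<mu> * (a + \<tau>))) *\<^sub>R T (a + 3 * \<tau>) (Cplx x 0)"
  proof -
    have e: "exp (- \<mu> * (a + \<tau>)) = exp (- \<mu> * a) * exp (- \<mu> * \<tau>)"
      by (simp only: distrib_left exp_add)
    have T: "T (a + \<tau>) u = T a (T \<tau> u)"
      "T (a + 3 * \<tau>) (Cplx x 0) = T a (T (3 * \<tau>) (Cplx x 0))"
      using a \<tau>_ge_1 by (simp_all add: T_add)
    show ?thesis unfolding w_def e T Ta.diff Ta.scaleR by (simp add: scaleR_diff_right mult_ac)
  qed
  finally have "exp (- \<mu> * a) *\<^sub>R T a u - exp (- \<mu> * (a + \<tau>)) *\<^sub>R T (a + \<tau>) u
      - (\<tau> * exp (- \<mu> * (a + \<tau>))) *\<^sub>R T (a + 3 * \<tau>) (Cplx x 0) \<in> K" .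
  from convex_cone_add[OF convex_cone_K Suc.IH this] show ?case
    by (simp add: a_def algebra_simps)
qed

lemma shifted_Cesaro_bound:
  assumes M: "\<And>t y. t \<in> {0..\<tau>} \<Longrightarrow> norm (T t y) \<le> M * norm y" "1 \<le> M" and x: "0 \<le> x"
  shows "norm (\<Sum>i<n. T (real (i + 3) * \<tau>) (Cplx x 0)) \<le> exp 1 * C * M ^ 3 * real n * norm x"
proof (cases "n = 0")
  case False
  obtain z where z: "0 \<le> z" "norm z \<le> M\<^sup>2 * norm x"
    and up: "\<And>s. s \<in> {0..\<tau>} \<Longrightarrow> Cplx z 0 - T (s + \<tau>) (Cplx x 0) \<in> positive_cone"
    using orbit_upper_bound[OF M x] by blast
  \<comment> \<open>With this parameter every weight is at least \<open>\<tau> * exp (- 1)\<close>,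
    while the Kreiss bound \<open>C / \<mu> = C * n * \<tau>\<close> is linear in
    \<open>n\<close>.\<close>
  define \<mu> where "\<mu> = 1 / (real n * \<tau>)"
  have \<mu>: "0 < \<mu>" using False \<tau>_ge_1 by (simp add: \<mu>_def)
  define u where "u = R \<mu> (T \<tau> (Cplx z 0))"
  define X where "X i = T (real (i + 3) * \<tau>) (Cplx x 0)" for i
  have X: "X i \<in> K" for i
    unfolding X_def using x \<tau>_ge_1 by (intro positive_in_K) auto
  have u: "u \<in> K"
    unfolding u_def using z \<mu> by (intro resolvent_invariant closed_K convex_cone_K T_K positive_in_K) auto
  \<comment> \<open>The subtracted tail can be added back because \<open>u\<close> lies in
    \<open>K\<close>. This uses invariance under the resolvent at small parameters.\<close>
  have "exp (- \<mu> * (real n * \<tau>)) *\<^sub>R T (real n * \<tau>) u \<in> K"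
    using u \<tau>_ge_1 by (intro convex_cone_scaleR convex_cone_K T_K) auto
  from convex_cone_add[OF convex_cone_K weighted_sum_le_resolvent[OF \<mu> z(1) up, of n] this[unfolded u_def]]
  have 1: "u - (\<Sum>i<n. (\<tau> * exp (- \<mu> * (real (Suc i) * \<tau>))) *\<^sub>R X i) \<in> K"
    by (simp add: u_def X_def)
  have "(\<Sum>i<n. (\<tau> * exp (- \<mu> * (real (Suc i) * \<tau>)) - \<tau> * exp (- 1)) *\<^sub>R X i) \<in> K"
  proof (intro convex_cone_sum convex_cone_scaleR convex_cone_K X)
    fix i assume "i \<in> {..<n}"
    then have "real (Suc i) * \<tau> \<le> real n * \<tau>" using \<tau>_ge_1 by (intro mult_right_mono) auto
    then have "\<mu> * (real (Suc i) * \<tau>) \<le> \<mu> * (real n * \<tau>)" using \<mu> by (intro mult_left_mono) auto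
    then have "- 1 \<le> - \<mu> * (real (Suc i) * \<tau>)" using False \<tau>_ge_1 by (simp add: \<mu>_def)
    then show "0 \<le> \<tau> * exp (- \<mu> * (real (Suc i) * \<tau>)) - \<tau> * exp (- 1)"
      using \<tau>_ge_1 by simp
  qed
  from convex_cone_add[OF convex_cone_K 1 this]
  have "u - (\<tau> * exp (- 1)) *\<^sub>R (\<Sum>i<n. X i) \<in> K"
    by (simp add: scaleR_diff_left sum_subtractf scaleR_sum_right)
  moreover have "(\<tau> * exp (- 1)) *\<^sub>R (\<Sum>i<n. X i) \<in> K"
    using X \<tau>_ge_1 by (intro convex_cone_scaleR convex_cone_sum convex_cone_K) auto
  ultimately have "norm ((\<tau> * exp (- 1)) *\<^sub>R (\<Sum>i<n. X i)) \<le> norm u"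
    by (intro norm_mono_positive_cone K_subset)
  also have "\<dots> \<le> C / \<mu> * norm (T \<tau> (Cplx z 0))" unfolding u_def by (rule norm_R[OF \<mu>])
  also have "\<dots> \<le> C / \<mu> * (M * (M\<^sup>2 * norm x))"
    using M(1)[of \<tau> "Cplx z 0"] z(2) M(2) C_ge_1 \<mu> \<tau>_ge_1
    by (intro mult_left_mono) (auto simp: norm_Cplx_0 intro: order_trans mult_left_mono)
  also have "\<dots> = \<tau> * (C * M ^ 3 * real n * norm x)"
    by (simp add: \<mu>_def power2_eq_square power3_eq_cube)
  finally have "exp (- 1) * norm (\<Sum>i<n. X i) \<le> C * M ^ 3 * real n * norm x"
    using \<tau>_ge_1 by (simp add: mult.assoc)
  then have "exp 1 * (exp (- 1) * norm (\<Sum>i<n. X i)) \<le> exp 1 * (C * M ^ 3 * real n * norm x)"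
    by (intro mult_left_mono) auto
  also have "exp 1 * (exp (- 1) * norm (\<Sum>i<n. X i)) = norm (\<Sum>i<n. X i)"
    by (simp add: mult.assoc[symmetric] mult_exp_exp)
  finally show ?thesis by (simp add: X_def mult_ac)
qed simp

text \<open>Appending three positive terms only increases the norm. Of the \<open>n + 3\<close>
  samples the last \<open>n\<close> form the shifted sum, and the first three cost a constant,
  absorbed into the linear bound since \<open>n \<ge> 1\<close>.\<close>

lemma Cesaro_bound:
  assumes M: "\<And>t y. t \<in> {0..\<tau>} \<Longrightarrow> norm (T t y) \<le> M * norm y" "1 \<le> M" and x: "0 \<le> x"
  shows "norm (\<Sum>i<n. T (real i * \<tau>) (Cplx x 0)) \<le> (3 * M\<^sup>2 + exp 1 * C * M ^ 3) * real n * norm x"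
proof (cases "n = 0")
  case False
  define X where "X i = T (real i * \<tau>) (Cplx x 0)" for i
  have X: "X i \<in> positive_cone" for i
  proof (cases "i = 0")
    case False
    then have "1 * \<tau> \<le> real i * \<tau>" using \<tau>_ge_1 by (intro mult_right_mono) auto
    then show ?thesis unfolding X_def using x by (intro positive) auto
  qed (use x in \<open>simp add: X_def\<close>)
  have "(\<Sum>i<n + 3. X i) = (\<Sum>i<n. X i) + (\<Sum>i\<in>{n..<n + 3}. X i)"
    by (simp add: lessThan_atLeast0 sum.atLeastLessThan_concat)
  then have "(\<Sum>i<n + 3. X i) - (\<Sum>i<n. X i) \<in> positive_cone"
    using X by (simp add: convex_cone_sum convex_cone_positive_cone del: sum.op_ivl_Suc)
  then have "norm (\<Sum>i<n. X i) \<le> norm (\<Sum>i<n + 3. X i)"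
    using X by (intro norm_mono_positive_cone convex_cone_sum convex_cone_positive_cone)
  also have "(\<Sum>i<n + 3. X i) = (\<Sum>i<3. X i) + (\<Sum>i<n. X (i + 3))"
    using sum.shift_bounds_nat_ivl[of X 0 3 n] sum.atLeastLessThan_concat[of 0 3 "n + 3" X]
    by (simp add: lessThan_atLeast0)
  also have "norm \<dots> \<le> norm (\<Sum>i<3. X i) + norm (\<Sum>i<n. X (i + 3))" by (rule norm_triangle_ineq)
  also have "norm (\<Sum>i<n. X (i + 3)) \<le> exp 1 * C * M ^ 3 * real n * norm x"
    unfolding X_def by (rule shifted_Cesaro_bound[OF M x])
  also have "norm (\<Sum>i<3. X i) \<le> 3 * M\<^sup>2 * norm x"
  proof -
    have step: "norm (X (Suc i)) \<le> M * norm (X i)" for i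
    proof -
      have "X (Suc i) = T \<tau> (X i)" using \<tau>_ge_1 by (simp add: X_def T_add distrib_right)
      then show ?thesis using M(1)[of \<tau>] \<tau>_ge_1 by simp
    qed
    have X0: "norm (X 0) = norm x" by (simp add: X_def norm_Cplx_0)
    have "norm (X i) \<le> M\<^sup>2 * norm x" if "i \<in> {..<3}" for i
    proof -
      have "norm (X i) \<le> M ^ i * norm x"
      proof (induction i)
        case (Suc i)
        then show ?case using order_trans[OF step mult_left_mono[OF Suc]] M(2) by (simp add: mult_ac)
      qed (simp add: X0)
      also have "\<dots> \<le> M\<^sup>2 * norm x"
        using that M(2) by (intro mult_right_mono power_increasing) auto
      finally show ?thesis .
    qed
    then have "norm (\<Sum>i<3. X i) \<le> of_nat (card {..<3::nat}) * (M\<^sup>2 * norm x)"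
      by (intro sum_norm_bound)
    then show ?thesis by simp
  qed
  also have "3 * M\<^sup>2 * norm x \<le> 3 * M\<^sup>2 * norm x * real n"
    using False mult_left_mono[of 1 "real n" "3 * M\<^sup>2 * norm x"] by simp
  finally show ?thesis by (simp add: X_def algebra_simps)
qed simp

section \<open>Growth along multiples of \<open>\<tau>\<close> and then at all times\<close>

lemma growth_at_multiples:
  "\<exists>D\<ge>1. \<forall>n z. norm (T (real n * \<tau>) z) \<le> 4 * (D * real (Suc n) powr (1 - 1 / (4 * D))) * norm z"
proof -
  obtain M where M: "1 \<le> M" "\<And>t y. t \<in> {0..\<tau>} \<Longrightarrow> norm (T t y) \<le> M * norm y"
    using bounded_on_interval[of \<tau>] by blast
  define D where "D = 3 * M\<^sup>2 + exp 1 * C * M ^ 3"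
  have "1 \<le> M\<^sup>2" using M(1) by (rule one_le_power)
  moreover have "0 \<le> exp 1 * C * M ^ 3" using C_ge_1 M(1) by simp
  ultimately have D: "1 \<le> D" unfolding D_def by linarith
  \<comment> \<open>On positive vectors the imaginary part of the image is zero, so there
    \<open>P\<close> is \<open>T \<tau>\<close> itself and its powers give the samples.\<close>
  define P where "P x = RePart (T \<tau> (Cplx x 0))" for x
  have \<tau>: "0 \<le> \<tau>" using \<tau>_ge_1 by simp
  have lin: "linear P"
    using linear_compose[OF linear_compose[OF linear_Cplx_0 bounded_linear.linear[OF bounded_linear_T[OF \<tau>]]]
        bounded_linear.linear[OF bounded_linear_RePart]]
    by (simp add: P_def[abs_def] comp_def)
  have pos: "0 \<le> P x" and T_P: "T \<tau> (Cplx x 0) = Cplx (P x) 0" if "0 \<le> x" for x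
    using positive[of \<tau> "Cplx x 0"] that by (auto simp: P_def positive_cone_iff Cplx_RePart)
  have pow: "T (real i * \<tau>) (Cplx x 0) = Cplx ((P ^^ i) x) 0 \<and> 0 \<le> (P ^^ i) x" if "0 \<le> x" for i x
  proof -
    have "(T \<tau> ^^ i) (Cplx x 0) = Cplx ((P ^^ i) x) 0 \<and> 0 \<le> (P ^^ i) x"
      using that by (induction i) (auto simp: T_P pos)
    then show ?thesis by (simp add: T_funpow[OF \<tau>])
  qed
  have cesaro: "norm (\<Sum>i<n. (P ^^ i) x) \<le> D * real n * norm x" if x: "0 \<le> x" for n x
  proof -
    have "(\<Sum>i<n. T (real i * \<tau>) (Cplx x 0)) = Cplx (\<Sum>i<n. (P ^^ i) x) 0"
      using pow[OF x] by (simp add: linear_sum[OF linear_Cplx_0])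
    then show ?thesis using Cesaro_bound[OF M(2,1) x, of n] by (simp add: norm_Cplx_0 D_def)
  qed
  have "norm (T (real n * \<tau>) z) \<le> 4 * (D * real (Suc n) powr (1 - 1 / (4 * D))) * norm z" for n z
  proof (rule norm_le_4_positive)
    show "bounded_clinear (T (real n * \<tau>))" using C0 \<tau> by (simp add: C0_semigroup_def)
    show "0 \<le> D * real (Suc n) powr (1 - 1 / (4 * D))" using D by simp
    show "norm (T (real n * \<tau>) (Cplx x 0)) \<le> D * real (Suc n) powr (1 - 1 / (4 * D)) * norm x"
      if "0 \<le> x" for x
      using Cesaro_bounded_growth[OF lin pos D cesaro that, of n] pow[OF that, of n]
      by (simp add: norm_Cplx_0)
  qed
  then show ?thesis using D by blast
qed

lemma growth:
  "\<exists>\<epsilon>::real. 0 < \<epsilon> \<and> \<epsilon> < 1 \<and> (\<lambda>t. onorm (T t)) \<in> O[at_top](\<lambda>t. t powr (1 - \<epsilon>))"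
proof -
  obtain D where D: "1 \<le> D"
    and mult: "\<And>n z. norm (T (real n * \<tau>) z) \<le> 4 * (D * real (Suc n) powr (1 - 1 / (4 * D))) * norm z"
    using growth_at_multiples by blast
  obtain M where M: "1 \<le> M" "\<And>t y. t \<in> {0..\<tau>} \<Longrightarrow> norm (T t y) \<le> M * norm y"
    using bounded_on_interval[of \<tau>] by blast
  define \<epsilon> where "\<epsilon> = 1 / (4 * D)"
  have \<epsilon>: "0 < \<epsilon>" "\<epsilon> < 1" using D by (auto simp: \<epsilon>_def field_simps)
  have "onorm (T t) \<le> 8 * D * M * t powr (1 - \<epsilon>)" if t: "1 \<le> t" for t
  proof (rule onorm_bound)
    fix z
    define n where "n = nat \<lfloor>t / \<tau>\<rfloor>"
    have "0 \<le> t / \<tau>" using t \<tau>_ge_1 by simp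
    then have n: "real n \<le> t / \<tau>" "t / \<tau> < real n + 1" unfolding n_def by linarith+
    have n1: "real n * \<tau> \<le> t" and n2: "t - real n * \<tau> \<le> \<tau>"
      using n \<tau>_ge_1 by (auto simp: field_simps)
    have "real n \<le> real n * \<tau>" using \<tau>_ge_1 mult_left_mono[of 1 \<tau> "real n"] by simp
    \<comment> \<open>From \<open>\<tau> \<ge> 1\<close> follows \<open>n \<le> t\<close>, and
      \<open>t \<ge> 1\<close> absorbs the successor.\<close>
    then have "real (Suc n) \<le> 2 * t" using n1 t by simp
    then have "real (Suc n) powr (1 - \<epsilon>) \<le> (2 * t) powr (1 - \<epsilon>)"
      using \<epsilon> by (intro powr_mono2) auto
    also have "\<dots> = 2 powr (1 - \<epsilon>) * t powr (1 - \<epsilon>)" using t by (simp add: powr_mult)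
    also have "\<dots> \<le> 2 powr 1 * t powr (1 - \<epsilon>)"
      using \<epsilon> by (intro mult_right_mono powr_mono) auto
    finally have pw: "real (Suc n) powr (1 - \<epsilon>) \<le> 2 * t powr (1 - \<epsilon>)" by simp
    have "T t z = T (real n * \<tau>) (T (t - real n * \<tau>) z)"
      using T_add[of "real n * \<tau>" "t - real n * \<tau>" z] n1 \<tau>_ge_1 by simp
    also have "norm \<dots> \<le> 4 * (D * real (Suc n) powr (1 - \<epsilon>)) * norm (T (t - real n * \<tau>) z)"
      unfolding \<epsilon>_def by (rule mult)
    also have "\<dots> \<le> 4 * (D * (2 * t powr (1 - \<epsilon>))) * (M * norm z)"
      using D M(1) n1 n2 pw by (intro mult_mono M(2)) auto
    finally show "norm (T t z) \<le> 8 * D * M * t powr (1 - \<epsilon>) * norm z" by (simp add: mult_ac)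
  qed (use D M(1) in simp)
  then have "\<forall>\<^sub>F t in at_top. norm (onorm (T t)) \<le> (8 * D * M) * norm (t powr (1 - \<epsilon>))"
    using onorm_pos_le[OF bounded_linear_T]
    by (intro eventually_mono[OF eventually_ge_at_top[of 1]]) auto
  then have "(\<lambda>t. onorm (T t)) \<in> O[at_top](\<lambda>t. t powr (1 - \<epsilon>))" by (rule bigoI)
  with \<epsilon> show ?thesis by blast
qed

end

theorem theorem4p6:
  fixes T :: "real \<Rightarrow> 'a::real_am_space complexification \<Rightarrow> 'a complexification"
  assumes "C0_semigroup T"
    and "uniformly_eventually_positive T"
    and "Kreiss_bounded T"
  shows "\<exists>\<epsilon>::real. 0 < \<epsilon> \<and> \<epsilon> < 1 \<and> (\<lambda>t. onorm (T t)) \<in> O[at_top](\<lambda>t. t powr (1 - \<epsilon>))"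
proof -
  obtain C R where "kreiss_semigroup T C R" using kreiss_semigroupI assms(1,3) by blast
  then interpret kreiss_semigroup T C R .
  obtain t0 where t0: "0 \<le> t0" "\<And>t. t0 \<le> t \<Longrightarrow> positive_operator (T t)"
    using assms(2) by (auto simp: uniformly_eventually_positive_def)
  \<comment> \<open>The threshold may be raised freely; the maximum with \<open>1\<close> covers
    \<open>t0 = 0\<close>, which would be no sampling step.\<close>
  interpret eventually_positive_kreiss T C R "max t0 1"
    by standard (use t0(2) in \<open>auto simp: positive_operator_def\<close>)
  show ?thesis by (rule growth)
qed

end
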